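(* There is an absolute constant $C>0$ such that the following holds. Consider a finite-horizon Markov decision process with state space $\mathsf S\subset\mathbb R^{d_{\mathsf S}}$, action space $\mathsf A\subset\mathbb R^{d_{\mathsf A}}$, horizon $H\ge 1$, one-step transition densities $p_h^a(y|x)$ ($h=1,\dots,H$), rewards $R_h$ ($0\le h\le H-1$) and terminal reward $F$. Assume: (i) $\mathsf S$ and $\mathsf A$ are compact, with finite diameters $\mathrm{diam}(\mathsf S)$ and $\mathrm{diam}(\mathsf A)$; (ii) there are constants $\delta>0$, $\Lambda>0$, $L>0$ and a function $\mathcal L:\mathsf S\to\mathbb R_+$ with $\max\{\|\mathcal L\|_{L^1(\mathsf S)},\|\mathcal L\|_{L^\infty(\mathsf S)}\}\le L$ such that $$0<\delta\le p_h^a(y|x)\le\Lambda,\qquad |p_h^{a_1}(y|x_1)-p_h^{a_2}(y|x_2)|\le\mathcal L(y)\,\bigl(|x_1-x_2|+\rho_{\mathsf A}(a_1,a_2)\bigr)$$ for all $x,x_1,x_2,y\in\mathsf S$, $a,a_1,a_2\in\mathsf A$, $h=1,\dots,H$; (iii) there is a constant $G>0$ with $\max\{|R_h(s,a)|,|F(s)|\}\le G$ for all $(s,a)\in\mathsf S\times\mathsf A$ and $0\le h\le H-1$. Fix $x_0\in\mathsf S$ and controls $b_0,\dots,b_{H-1}\in\mathsf A$, and let $\overline V_0(x_0)$ be the output of the weighted mesh algorithm with $N$ simulated trajectories. Then there is $N_0$ such that for all $N>N_0$, with expectation taken over the simulations used in the algorithm, $$\mathbb E\bigl[|\overline V_0(x_0)-V_0^\star(x_0)|\bigr]\le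 C\,\frac{H^2G}{\sqrt N}\left(\frac{L\,\mathrm{DI}(\mathsf S\times\mathsf A)+L\,\mathrm{diam}(\mathsf S)\,\mathrm{diam}(\mathsf A)+\Lambda}{\delta}+\frac{\Lambda^2}{\delta^2}\right).$$
   Context: **MDP.** $|\cdot|$ is the Euclidean norm on $\mathsf S\subset\mathbb R^{d_{\mathsf S}}$, and $\rho_{\mathsf A}$ is the metric on $\mathsf A\subset\mathbb R^{d_{\mathsf A}}$ (diameters of $\mathsf S$, $\mathsf A$ are with respect to these). For $h=1,\dots,H$, $P_h(\cdot|x,a)$ is a probability kernel from $\mathsf S\times\mathsf A$ to $\mathsf S$ with Lebesgue density $y\mapsto p_h^a(y|x)$. $R_h:\mathsf S\times\mathsf A\to\mathbb R$ ($0\le h\le H-1$) and $F:\mathsf S\to\mathbb R$ are the rewards. A policy is $\boldsymbol\pi=(\pi_0,\dots,\pi_{H-1})$ with measurable $\pi_t:\mathsf S\to\mathcal P(\mathsf A)$ (probability measures on $\mathsf A$); $\Pi$ is the set of policies. Under $\boldsymbol\pi$ the controlled process satisfies $A_t\sim\pi_t(S_t)$, $S_{t+1}\sim P_{t+1}(\cdot|S_t,A_t)$. The optimal value function is $$V_h^\star(x)=\sup_{\boldsymbol\pi\in\Pi}\mathbb E_{\boldsymbol\pi}\Bigl[\sum_{t=h}^{H-1}R_t(S_t,A_t)+F(S_H)\,\Big|\,S_h=x\Bigr].$$ Standing convention: the data are regular enough (e.g. $R_h$, $F$ continuous) that all functions involved are measurable and the Bellman equations hold: $V_H^\star=F$ and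 $V_h^\star(x)=\sup_{a\in\mathsf A}\bigl(R_h(x,a)+\int_{\mathsf S}V_{h+1}^\star(z)\,p_{h+1}^a(z|x)\,dz\bigr)$ for $h=H-1,\dots,0$. **Weighted mesh algorithm.** Simulate independently for $n=1,\dots,N$ ($N\ge2$) chains $(S_h^{(n)})_{0\le h\le H}$ with $S_0^{(n)}=x_0$ and $S_{h+1}^{(n)}\sim P_{h+1}(\cdot|S_h^{(n)},b_h)$. Define weights (with $0/0=0$) $$w_{h,n,N}(x,a)=\frac{p_{h+1}^a(S_{h+1}^{(n)}|x)}{\sum_{k\ne n}p_{h+1}^{b_h}(S_{h+1}^{(n)}|S_h^{(k)})}\Big/\sum_{n'=1}^N\frac{p_{h+1}^a(S_{h+1}^{(n')}|x)}{\sum_{k'\ne n'}p_{h+1}^{b_h}(S_{h+1}^{(n')}|S_h^{(k')})},$$ where $k,k'$ range over $\{1,\dots,N\}$. Put $\overline V_H(S_H^{(n)})=F(S_H^{(n)})$ and, for $h=H-1,\dots,0$ and $r=1,\dots,N$, $$\overline V_h(S_h^{(r)})=\sup_{a\in\mathsf A}\Bigl(R_h(S_h^{(r)},a)+\sum_{n=1}^N\overline V_{h+1}(S_{h+1}^{(n)})\,w_{h,n,N}(S_h^{(r)},a)\Bigr).$$ The output is $\overline V_0(x_0)$ (recall $S_0^{(r)}=x_0$ for all $r$). **Dudley integral.** For a metric space $(\mathsf X,\rho)$, $\mathcal N(\mathsf X,\rho,u)$ is the smallest number of $\rho$-balls of radius $u$ covering $\mathsf X$, and $\mathrm{DI}(\mathsf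 X)=\int_0^{\mathrm{diam}(\mathsf X)}\sqrt{\log\mathcal N(\mathsf X,\rho,u)}\,du$. On $\mathsf S\times\mathsf A$ the metric is $\rho((x,a),(x',a'))=|x-x'|+\rho_{\mathsf A}(a,a')$. *)

theory Defs
  imports "HOL-Probability.Probability"
begin

text \<open>
  The constant in the main statement may not depend on the dimensions of the state and action
  spaces. A constant quantified inside a formula could depend on the types occurring there, so the
  dimension must not be a type: points of \<open>\<real>\<^sup>d\<close> are extensional functions on \<open>{..<d}\<close>, i.e. points
  of the product space \<^term>\<open>\<Pi>\<^sub>M i\<in>{..<d}. lborel\<close>, which carries \<open>d\<close>-dimensional Lebesgue measure.
\<close>

type_synonym point = "nat \<Rightarrow> real"

definition euclid_dist :: "nat \<Rightarrow> point \<Rightarrow> point \<Rightarrow> real" where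
  "euclid_dist d x y = L2_set (\<lambda>i. x i - y i) {..<d}"

lemma Metric_space_euclid:
  assumes "S \<subseteq> extensional {..<d}"
  shows "Metric_space S (euclid_dist d)"
proof
  fix x y z
  show "0 \<le> euclid_dist d x y" by (simp add: euclid_dist_def)
  show "euclid_dist d x y = euclid_dist d y x"
    by (simp add: euclid_dist_def L2_set_def power2_commute)
  show "(euclid_dist d x y = 0) = (x = y)" if "x \<in> S" "y \<in> S"
  proof -
    have "x = y" if "\<forall>i<d. x i = y i"
      using that \<open>x \<in> S\<close> \<open>y \<in> S\<close> assms by (auto intro: extensionalityI[of _ "{..<d}"])
    then show ?thesis by (auto simp: euclid_dist_def L2_set_eq_0_iff)
  qed
  have "euclid_dist d x z = L2_set (\<lambda>i. (x i - y i) + (y i - z i)) {..<d}"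
    by (simp add: euclid_dist_def)
  also have "\<dots> \<le> euclid_dist d x y + euclid_dist d y z"
    unfolding euclid_dist_def by (rule L2_set_triangle_ineq)
  finally show "euclid_dist d x z \<le> euclid_dist d x y + euclid_dist d y z" .
qed

definition sum_metric :: "'a metric \<Rightarrow> 'b metric \<Rightarrow> ('a \<times> 'b) metric" where
  "sum_metric m1 m2 =
     metric (mspace m1 \<times> mspace m2, \<lambda>(x, a) (x', a'). mdist m1 x x' + mdist m2 a a')"

lemma Metric_space_sum:
  "Metric_space (mspace m1 \<times> mspace m2) (\<lambda>(x, a) (x', a'). mdist m1 x x' + mdist m2 a a')"
proof
  fix p q r :: "'a \<times> 'b"
  let ?d = "\<lambda>(x, a) (x', a'). mdist m1 x x' + mdist m2 a a'"
  show "0 \<le> ?d p q" by (auto split: prod.splits)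
  show "?d p q = ?d q p" by (auto split: prod.splits simp: mdist_commute)
  show "(?d p q = 0) = (p = q)" if "p \<in> mspace m1 \<times> mspace m2" "q \<in> mspace m1 \<times> mspace m2"
    using that by (auto split: prod.splits simp: add_nonneg_eq_0_iff)
  show "?d p r \<le> ?d p q + ?d q r"
    if "p \<in> mspace m1 \<times> mspace m2" "q \<in> mspace m1 \<times> mspace m2" "r \<in> mspace m1 \<times> mspace m2"
    using that mdist_triangle[of "fst p" m1 "fst q" "fst r"]
      mdist_triangle[of "snd p" m2 "snd q" "snd r"]
    by (auto split: prod.splits)
qed

definition mdiam :: "'a metric \<Rightarrow> real" where
  "mdiam m = (SUP (x, y) \<in> mspace m \<times> mspace m. mdist m x y)"

text \<open>The minimum exists for \<open>u > 0\<close> when the space is totally bounded, in particular compact.\<close>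

definition covering_number :: "'a metric \<Rightarrow> real \<Rightarrow> nat" where
  "covering_number m u =
     (LEAST n. \<exists>C \<subseteq> mspace m. finite C \<and> card C = n \<and> mspace m \<subseteq> (\<Union>c\<in>C. mball_of m c u))"

text \<open>Possibly \<open>\<infinity>\<close>, because the metric on the action space is arbitrary.\<close>

definition dudley_integral :: "'a metric \<Rightarrow> ennreal" where
  "dudley_integral m =
     (\<integral>\<^sup>+u\<in>{0..mdiam m}. ennreal (sqrt (ln (real (covering_number m u)))) \<partial>lborel)"

text \<open>
  \<open>dens D h x a y\<close> is \<open>p\<^sub>h\<^sup>a(y | x)\<close>. The metric on the actions need not be induced by the Euclidean
  norm, whereas the states always carry the Euclidean metric.
\<close>

record mdp =
  state_dim :: nat
  action_dim :: nat
  states :: "point set"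
  action_metric :: "point metric"
  horizon :: nat
  dens :: "nat \<Rightarrow> point \<Rightarrow> point \<Rightarrow> point \<Rightarrow> real"
  reward :: "nat \<Rightarrow> point \<Rightarrow> point \<Rightarrow> real"
  final_reward :: "point \<Rightarrow> real"

abbreviation actions :: "mdp \<Rightarrow> point set" where
  "actions D \<equiv> mspace (action_metric D)"

definition state_metric :: "mdp \<Rightarrow> point metric" where
  "state_metric D = metric (states D, euclid_dist (state_dim D))"

definition state_action_metric :: "mdp \<Rightarrow> (point \<times> point) metric" where
  "state_action_metric D = sum_metric (state_metric D) (action_metric D)"

definition state_leb :: "mdp \<Rightarrow> point measure" where
  "state_leb D = restrict_space (\<Pi>\<^sub>M i\<in>{..<state_dim D}. lborel) (states D)"

text \<open>Only the \<open>\<sigma>\<close>-algebra matters here; the measure itself is irrelevant (it is zero).\<close>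

definition action_borel :: "mdp \<Rightarrow> point measure" where
  "action_borel D = sigma (actions D) {U. openin (mtopology_of (action_metric D)) U}"

definition kernel :: "mdp \<Rightarrow> nat \<Rightarrow> point \<Rightarrow> point \<Rightarrow> point measure" where
  "kernel D h x a = density (state_leb D) (\<lambda>y. ennreal (dens D h x a y))"

definition valid_mdp :: "mdp \<Rightarrow> bool" where
  "valid_mdp D \<longleftrightarrow>
     1 \<le> horizon D \<and>
     states D \<subseteq> extensional {..<state_dim D} \<and>
     actions D \<subseteq> extensional {..<action_dim D} \<and>
     (\<forall>h\<in>{1..horizon D}.
        (\<forall>x\<in>states D. \<forall>a\<in>actions D. dens D h x a \<in> borel_measurable (state_leb D)) \<and>
        (\<lambda>(x, a). kernel D h x a)
          \<in> state_leb D \<Otimes>\<^sub>M action_borel D \<rightarrow>\<^sub>M prob_algebra (state_leb D))"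

type_synonym policy = "nat \<Rightarrow> point \<Rightarrow> point measure"

definition policies :: "mdp \<Rightarrow> policy set" where
  "policies D = {\<pi>. \<forall>t<horizon D. \<pi> t \<in> state_leb D \<rightarrow>\<^sub>M prob_algebra (action_borel D)}"

definition path_space :: "mdp \<Rightarrow> nat \<Rightarrow> nat \<Rightarrow> ((nat \<Rightarrow> point) \<times> (nat \<Rightarrow> point)) measure" where
  "path_space D h t =
     (\<Pi>\<^sub>M i\<in>{h..t}. state_leb D) \<Otimes>\<^sub>M (\<Pi>\<^sub>M i\<in>{h..<t}. action_borel D)"

text \<open>
  \<open>path_law D \<pi> h x k\<close> is the joint law, given \<open>S\<^sub>h = x\<close>, of the states \<open>S\<^sub>h, \<dots>, S\<^bsub>h+k\<^esub>\<close> and the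
  actions \<open>A\<^sub>h, \<dots>, A\<^bsub>h+k-1\<^esub>\<close> under the policy \<open>\<pi>\<close>.
\<close>

primrec path_law ::
  "mdp \<Rightarrow> policy \<Rightarrow> nat \<Rightarrow> point \<Rightarrow> nat \<Rightarrow> ((nat \<Rightarrow> point) \<times> (nat \<Rightarrow> point)) measure" where
  "path_law D \<pi> h x 0 = return (path_space D h h) (\<lambda>i\<in>{h}. x, \<lambda>i\<in>{}. undefined)"
| "path_law D \<pi> h x (Suc k) =
     path_law D \<pi> h x k \<bind> (\<lambda>(s, \<alpha>).
       \<pi> (h + k) (s (h + k)) \<bind> (\<lambda>a.
         kernel D (Suc (h + k)) (s (h + k)) a \<bind> (\<lambda>y.
           return (path_space D h (Suc (h + k))) (s(Suc (h + k) := y), \<alpha>(h + k := a)))))"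

definition policy_value :: "mdp \<Rightarrow> policy \<Rightarrow> nat \<Rightarrow> point \<Rightarrow> real" where
  "policy_value D \<pi> h x =
     (\<integral>(s, \<alpha>). (\<Sum>t\<in>{h..<horizon D}. reward D t (s t) (\<alpha> t)) + final_reward D (s (horizon D))
        \<partial>path_law D \<pi> h x (horizon D - h))"

definition optimal_value :: "mdp \<Rightarrow> nat \<Rightarrow> point \<Rightarrow> real" where
  "optimal_value D h x = (SUP \<pi>\<in>policies D. policy_value D \<pi> h x)"

definition bellman :: "mdp \<Rightarrow> bool" where
  "bellman D \<longleftrightarrow>
     (\<forall>x\<in>states D. optimal_value D (horizon D) x = final_reward D x) \<and>
     (\<forall>h<horizon D. \<forall>x\<in>states D.
        optimal_value D h x =
          (SUP a\<in>actions D. reward D h x a +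
             (\<integral>z. optimal_value D (Suc h) z * dens D (Suc h) x a z \<partial>state_leb D)))"

text \<open>Law of the states \<open>S\<^sub>0, \<dots>, S\<^sub>k\<close> of one chain started at \<open>x0\<close> with controls \<open>b\<close>.\<close>

primrec chain_law :: "mdp \<Rightarrow> (nat \<Rightarrow> point) \<Rightarrow> point \<Rightarrow> nat \<Rightarrow> (nat \<Rightarrow> point) measure" where
  "chain_law D b x0 0 = return (\<Pi>\<^sub>M i\<in>{..0}. state_leb D) (\<lambda>i\<in>{..0}. x0)"
| "chain_law D b x0 (Suc k) =
     chain_law D b x0 k \<bind> (\<lambda>s.
       kernel D (Suc k) (s k) (b k) \<bind> (\<lambda>y.
         return (\<Pi>\<^sub>M i\<in>{..Suc k}. state_leb D) (s(Suc k := y))))"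

text \<open>
  The \<open>N\<close> independent chains. A sample point \<open>\<omega>\<close> encodes \<open>S\<^sub>h\<^sup>(\<^sup>n\<^sup>)\<close> as \<open>\<omega> n h\<close>.
\<close>

definition sample_law ::
  "mdp \<Rightarrow> (nat \<Rightarrow> point) \<Rightarrow> point \<Rightarrow> nat \<Rightarrow> (nat \<Rightarrow> nat \<Rightarrow> point) measure" where
  "sample_law D b x0 N = (\<Pi>\<^sub>M n\<in>{1..N}. chain_law D b x0 (horizon D))"

definition mesh_ratio ::
  "mdp \<Rightarrow> (nat \<Rightarrow> point) \<Rightarrow> nat \<Rightarrow> (nat \<Rightarrow> nat \<Rightarrow> point) \<Rightarrow> nat \<Rightarrow> nat \<Rightarrow> point \<Rightarrow> point \<Rightarrow> real" where
  "mesh_ratio D b N \<omega> h n x a =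
     dens D (Suc h) x a (\<omega> n (Suc h)) /
     (\<Sum>k\<in>{1..N} - {n}. dens D (Suc h) (\<omega> k h) (b h) (\<omega> n (Suc h)))"

definition mesh_weight ::
  "mdp \<Rightarrow> (nat \<Rightarrow> point) \<Rightarrow> nat \<Rightarrow> (nat \<Rightarrow> nat \<Rightarrow> point) \<Rightarrow> nat \<Rightarrow> nat \<Rightarrow> point \<Rightarrow> point \<Rightarrow> real" where
  "mesh_weight D b N \<omega> h n x a =
     mesh_ratio D b N \<omega> h n x a / (\<Sum>n'\<in>{1..N}. mesh_ratio D b N \<omega> h n' x a)"

text \<open>
  The recursion makes sense at every \<open>x\<close>, although it only calls itself at the sampled states
  \<open>\<omega> n (Suc h)\<close>.
\<close>

function mesh_value ::
  "mdp \<Rightarrow> (nat \<Rightarrow> point) \<Rightarrow> nat \<Rightarrow> (nat \<Rightarrow> nat \<Rightarrow> point) \<Rightarrow> nat \<Rightarrow> point \<Rightarrow> real" where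
  "mesh_value D b N \<omega> h x =
     (if h < horizon D
      then SUP a\<in>actions D. reward D h x a +
             (\<Sum>n\<in>{1..N}. mesh_value D b N \<omega> (Suc h) (\<omega> n (Suc h)) * mesh_weight D b N \<omega> h n x a)
      else final_reward D x)"
  by pat_completeness auto
termination
  by (relation "Wellfounded.measure (\<lambda>(D, b, N, \<omega>, h, x). horizon D - h)") auto

declare mesh_value.simps [simp del]

text \<open>
  All functions involved are measurable and the Bellman equations hold. The measurability of the
  output of the algorithm is included since a supremum over uncountably many actions need not
  be measurable.
\<close>

definition regular_data :: "mdp \<Rightarrow> (nat \<Rightarrow> point) \<Rightarrow> point \<Rightarrow> bool" where
  "regular_data D b x0 \<longleftrightarrow>
     (\<forall>h<horizon D.
        (\<lambda>(x, a). reward D h x a) \<in> borel_measurable (state_leb D \<Otimes>\<^sub>M action_borel D)) \<and>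
     final_reward D \<in> borel_measurable (state_leb D) \<and>
     (\<forall>h\<le>horizon D. optimal_value D h \<in> borel_measurable (state_leb D)) \<and>
     bellman D \<and>
     (\<forall>N\<ge>2. (\<lambda>\<omega>. mesh_value D b N \<omega> 0 x0) \<in> borel_measurable (sample_law D b x0 N))"

end

theory Submission
  imports Defs
begin

text \<open>
  The weights are nonnegative and sum to one, so the error at time \<open>h\<close> is at most the largest error
  at time \<open>h + 1\<close> plus the one-step error
  \<open>sup \<bar>\<Sum>\<^sub>n V\<^sub>h\<^sub>+\<^sub>1(S\<^sub>h\<^sub>+\<^sub>1\<^sup>n) w\<^sub>n(x, a) - \<integral>V\<^sub>h\<^sub>+\<^sub>1(z) p\<^sup>a(z | x) dz\<bar>\<close>
  over all states and actions, and it suffices to bound the expectation of the latter. Replacing the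
  leave-one-out sums in the weights by full sums costs \<open>O(1 / N)\<close>. Given the states at time \<open>h\<close>, the
  states at time \<open>h + 1\<close> are independent, and the importance-weighted sum becomes a centred sum of
  \<open>N\<close> independent variables of size \<open>O(1 / N)\<close>, Lipschitz in \<open>(x, a)\<close>. Hoeffding's lemma makes it a
  subgaussian process, whose supremum is bounded by Dudley's chaining; the normalisation of the
  weights is the same process for the constant function \<open>1\<close>. Since \<open>\<bar>V\<^sub>h\<bar> \<le> (H - h + 1) G\<close>, summing
  over \<open>h\<close> gives the factor \<open>H\<^sup>2 G\<close>.
\<close>

section \<open>Chaining\<close>

text \<open>The supremum over uncountably many states and actions need not be measurable, so it is
  never integrated. Each probabilistic estimate instead produces an integrable variable that almost
  surely dominates the error at all states and actions at once, and only its expectation is bounded.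
  Chaining reaches a finite net; the gap to the full space is closed pathwise, on the almost sure
  event that \<open>\<L>\<close> is at most \<open>L\<close> at all simulated states from time 1 on.
  Uniformity in the state is essential, since the recursion evaluates the error at sampled states
  that also occur in the weights. Independence given the states at time \<open>h\<close> enters only
  through a bound on exponential moments that is the same for all such states, so it passes to the
  joint law by disintegration. The normaliser of the weights needs no quantitative lower bound: for
  the numerator \<open>A\<close>, the normaliser \<open>B\<close> and the target \<open>I\<close>,
  \<open>A / B - I = (A / B) * (1 - B) + (A - I)\<close>, where \<open>A / B\<close> is a weighted
  average and hence bounded. Two processes, each with chaining constant 12, give the final
  24.\<close>

lemma le_sqrt_if_le_all:
  fixes m a b :: real
  assumes "0 \<le> a" "0 \<le> b" and le: "\<And>l. l > 0 \<Longrightarrow> m \<le> a / l + l * b / 2"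
  shows "m \<le> sqrt (2 * b * a)"
proof -
  consider "a > 0" "b > 0" | "a = 0" | "b = 0" using assms(1,2) by linarith
  then show ?thesis
  proof cases
    case 1
    \<comment> \<open>The minimiser of \<open>a / l + l * b / 2\<close>; both terms are equal
      there.\<close>
    define l where "l = sqrt (2 * a / b)"
    have l: "l > 0" "l\<^sup>2 = 2 * a / b" using 1 by (auto simp: l_def)
    have "a / l + l * b / 2 = l * b"
      using l 1 by (simp add: field_simps power2_eq_square)
    moreover have "(l * b)\<^sup>2 = 2 * b * a"
      using l 1 by (simp add: power_mult_distrib) (simp add: power2_eq_square)
    then have "l * b = sqrt (2 * b * a)"
      using l 1 by (metis abs_of_pos mult_pos_pos real_sqrt_abs)
    ultimately show ?thesis using le[OF l(1)] by simp
  next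
    case 2
    \<comment> \<open>With \<open>a = 0\<close> the infimum is 0 but is approached only as
      \<open>l\<close> tends to 0; for \<open>b = 0\<close> below, only as \<open>l\<close> tends to
      infinity.\<close>
    have "m \<le> 0 + e" if "e > 0" for e
    proof -
      have "m \<le> e / (b + 1) * b / 2" using le[of "e / (b + 1)"] that 2 assms by simp
      also have "\<dots> \<le> e" using that assms(2)
        by (simp add: field_simps)
      finally show ?thesis by simp
    qed
    then show ?thesis using 2 field_le_epsilon[of m 0] by simp
  next
    case 3
    have "m \<le> 0 + e" if "e > 0" for e
    proof -
      have "m \<le> a / ((a + 1) / e)" using le[of "(a + 1) / e"] that 3 assms by simp
      also have "\<dots> \<le> e" using that assms(1) by (simp add: field_simps)
      finally show ?thesis by simp
    qed
    then show ?thesis using 3 field_le_epsilon[of m 0] by simp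
  qed
qed

lemma integrable_Max_image:
  fixes X :: "'i \<Rightarrow> 'a \<Rightarrow> real"
  assumes "finite J" "J \<noteq> {}" "\<And>j. j \<in> J \<Longrightarrow> integrable M (X j)"
  shows "integrable M (\<lambda>x. Max ((\<lambda>j. X j x) ` J))"
  using assms
proof (induction J rule: finite_ne_induct)
  case (insert j J)
  then have "(\<lambda>x. Max ((\<lambda>j. X j x) ` insert j J)) = (\<lambda>x. max (X j x) (Max ((\<lambda>j. X j x) ` J)))"
    by (auto simp: fun_eq_iff)
  with insert show ?case by (auto intro!: integrable_max)
qed simp

text \<open>The exponential moment method: Jensen's inequality, then the exponential of the maximum
  is at most the sum of the exponentials, then optimisation over \<open>l\<close> by
  \<open>le_sqrt_if_le_all\<close>. With the moments given as nonnegative integrals, integrability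
  of the exponentials is a consequence of the bound.\<close>

lemma (in prob_space) expectation_Max_le:
  fixes X :: "'i \<Rightarrow> 'a \<Rightarrow> real"
  assumes J: "finite J" "J \<noteq> {}" and "0 \<le> v"
    and int: "\<And>j. j \<in> J \<Longrightarrow> integrable M (X j)"
    and mgf: "\<And>j l. j \<in> J \<Longrightarrow> l > 0 \<Longrightarrow>
      (\<integral>\<^sup>+x. ennreal (exp (l * X j x)) \<partial>M) \<le> ennreal (exp (l\<^sup>2 * v / 2))"
  shows "expectation (\<lambda>x. Max ((\<lambda>j. X j x) ` J)) \<le> sqrt (2 * v * ln (real (card J)))"
proof -
  define Y where "Y x = Max ((\<lambda>j. X j x) ` J)" for x
  have Y: "integrable M Y" unfolding Y_def using integrable_Max_image[OF J int] by simp
  then have [measurable]: "Y \<in> borel_measurable M" by simp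
  have [measurable]: "X j \<in> borel_measurable M" if "j \<in> J" for j using int[OF that] by simp
  define m where "m = expectation Y"
  have c: "card J \<ge> 1" using J by (simp add: Suc_le_eq card_gt_0_iff)
  have "m \<le> ln (card J) / l + l * v / 2" if l: "l > 0" for l
  proof -
    have "(\<integral>\<^sup>+x. ennreal (exp (l * Y x)) \<partial>M) \<le> (\<integral>\<^sup>+x. (\<Sum>j\<in>J. ennreal (exp (l * X j x))) \<partial>M)"
    proof (rule nn_integral_mono)
      fix x
      have "Y x \<in> (\<lambda>j. X j x) ` J" unfolding Y_def using J by (intro Max_in) auto
      then obtain j where "j \<in> J" "Y x = X j x" by auto
      moreover have "ennreal (exp (l * X j x)) \<le> (\<Sum>j\<in>J. ennreal (exp (l * X j x)))"
        using J(1) \<open>j \<in> J\<close> by (intro member_le_sum[of j J "\<lambda>j. ennreal (exp (l * X j x))"]) auto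
      ultimately show "ennreal (exp (l * Y x)) \<le> (\<Sum>j\<in>J. ennreal (exp (l * X j x)))"
        by simp
    qed
    also have "\<dots> = (\<Sum>j\<in>J. (\<integral>\<^sup>+x. ennreal (exp (l * X j x)) \<partial>M))"
      by (intro nn_integral_sum) auto
    also have "\<dots> \<le> (\<Sum>j\<in>J. ennreal (exp (l\<^sup>2 * v / 2)))"
      by (intro sum_mono mgf l)
    also have "\<dots> = ennreal (card J * exp (l\<^sup>2 * v / 2))"
      by (simp add: ennreal_mult ennreal_of_nat_eq_real_of_nat)
    finally have le: "(\<integral>\<^sup>+x. ennreal (exp (l * Y x)) \<partial>M) \<le> ennreal (card J * exp (l\<^sup>2 * v / 2))" .
    have int_exp: "integrable M (\<lambda>x. exp (l * Y x))"
      by (rule integrableI_nonneg) (use le in \<open>auto intro: le_less_trans[OF _ ennreal_less_top]\<close>)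
    \<comment> \<open>Jensen's inequality by hand: the exponential lies above its tangent at
      \<open>l * m\<close>, and the tangent, evaluated at \<open>l * Y\<close>, has expectation
      \<open>exp (l * m)\<close>.\<close>
    have "exp (l * m) = expectation (\<lambda>x. exp (l * m) * (1 + l * (Y x - m)))"
      using Y by (simp add: m_def prob_space)
    also have "\<dots> \<le> expectation (\<lambda>x. exp (l * Y x))"
    proof (rule integral_mono)
      show "integrable M (\<lambda>x. exp (l * m) * (1 + l * (Y x - m)))" using Y by simp
      fix x
      have "exp (l * m) * (1 + l * (Y x - m)) \<le> exp (l * m) * exp (l * (Y x - m))"
        using exp_ge_add_one_self[of "l * (Y x - m)"] by simp
      also have "\<dots> = exp (l * Y x)" by (simp add: exp_add[symmetric] algebra_simps)
      finally show "exp (l * m) * (1 + l * (Y x - m)) \<le> exp (l * Y x)" .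
    qed (fact int_exp)
    also have "\<dots> \<le> card J * exp (l\<^sup>2 * v / 2)"
      using le by (subst (asm) nn_integral_eq_integral[OF int_exp]) auto
    finally have "ln (exp (l * m)) \<le> ln (card J * exp (l\<^sup>2 * v / 2))"
      using c by (subst ln_le_cancel_iff) auto
    then have "l * m \<le> ln (card J) + l\<^sup>2 * v / 2" using c by (simp add: ln_mult)
    then have "m \<le> (ln (card J) + l\<^sup>2 * v / 2) / l" using l by (simp add: field_simps)
    also have "\<dots> = ln (card J) / l + l * v / 2" using l by (simp add: field_simps power2_eq_square)
    finally show ?thesis .
  qed
  then have "m \<le> sqrt (2 * v * ln (card J))"
    using c \<open>0 \<le> v\<close> by (intro le_sqrt_if_le_all) auto
  then show ?thesis unfolding m_def Y_def .
qed

section \<open>Total boundedness, covering numbers and the entropy integral\<close>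

definition totally_bounded_metric :: "'a metric \<Rightarrow> bool" where
  "totally_bounded_metric m \<longleftrightarrow>
    (\<forall>u>0. \<exists>C \<subseteq> mspace m. finite C \<and> mspace m \<subseteq> (\<Union>c\<in>C. mball_of m c u))"

lemma compact_space_imp_totally_bounded_metric:
  assumes "compact_space (mtopology_of m)"
  shows "totally_bounded_metric m"
proof -
  interpret Metric_space "mspace m" "mdist m" by (rule Metric_space_mspace_mdist)
  have "compactin mtopology (mspace m)"
    using assms by (simp add: compact_space_def mtopology_of_def)
  then have "mtotally_bounded (mspace m)" by (rule compactin_imp_mtotally_bounded)
  then show ?thesis
    unfolding totally_bounded_metric_def mtotally_bounded_def mball_of_def by blast
qed

text \<open>A supremum of reals is an upper bound only if the distances are bounded, which a finite
  net of radius 1 provides.\<close>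

lemma mdist_le_mdiam:
  assumes "totally_bounded_metric m" "x \<in> mspace m" "y \<in> mspace m"
  shows "mdist m x y \<le> mdiam m"
proof -
  obtain C where C: "C \<subseteq> mspace m" "finite C" "mspace m \<subseteq> (\<Union>c\<in>C. mball_of m c 1)"
    using assms(1) unfolding totally_bounded_metric_def by (meson zero_less_one)
  \<comment> \<open>The double sum crudely dominates the distance of any two centres; the 2 pays for
    the two steps of length less than 1 from a point to its centre.\<close>
  define B where "B = (\<Sum>c\<in>C. \<Sum>d\<in>C. mdist m c d) + 2"
  have "mdist m u v \<le> B" if uv: "u \<in> mspace m" "v \<in> mspace m" for u v
  proof -
    obtain c d where cd: "c \<in> C" "d \<in> C" "mdist m c u < 1" "mdist m d v < 1"
      using C(3) uv by (simp add: subset_iff) metis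
    have cm: "c \<in> mspace m" "d \<in> mspace m" using cd C(1) by auto
    have "mdist m c d \<le> (\<Sum>d\<in>C. mdist m c d)"
      using C(2) cd by (intro member_le_sum) auto
    also have "\<dots> \<le> (\<Sum>c\<in>C. \<Sum>d\<in>C. mdist m c d)"
      using C(2) cd by (intro member_le_sum[where f = "\<lambda>c. \<Sum>d\<in>C. mdist m c d"] sum_nonneg) auto
    finally have "mdist m c d \<le> B - 2" by (simp add: B_def)
    moreover have "mdist m u v \<le> mdist m u c + mdist m c v" "mdist m c v \<le> mdist m c d + mdist m d v"
      using mdist_triangle uv cm by metis+
    ultimately show ?thesis using cd mdist_commute[of m u c] by linarith
  qed
  then have "bdd_above ((\<lambda>(x, y). mdist m x y) ` (mspace m \<times> mspace m))"
    by (intro bdd_aboveI[of _ B]) auto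
  then have "(\<lambda>(x, y). mdist m x y) (x, y) \<le> mdiam m"
    unfolding mdiam_def using assms by (intro cSUP_upper) auto
  then show ?thesis by simp
qed

text \<open>Total boundedness makes the set of admissible cardinalities nonempty, so the least
  element in \<open>covering_number\<close> is a genuine one.\<close>

lemma covering_number_attained:
  assumes "totally_bounded_metric m" "u > 0"
  shows "\<exists>C \<subseteq> mspace m. finite C \<and> card C = covering_number m u \<and> mspace m \<subseteq> (\<Union>c\<in>C. mball_of m c u)"
proof -
  obtain C where "C \<subseteq> mspace m" "finite C" "mspace m \<subseteq> (\<Union>c\<in>C. mball_of m c u)"
    using assms unfolding totally_bounded_metric_def by meson
  then have "\<exists>n. \<exists>C \<subseteq> mspace m. finite C \<and> card C = n \<and> mspace m \<subseteq> (\<Union>c\<in>C. mball_of m c u)"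
    by blast
  then show ?thesis unfolding covering_number_def by (rule LeastI_ex)
qed

lemma covering_number_antimono:
  assumes "totally_bounded_metric m" "0 < u" "u \<le> v"
  shows "covering_number m v \<le> covering_number m u"
proof -
  obtain C where C: "C \<subseteq> mspace m" "finite C" "card C = covering_number m u"
      "mspace m \<subseteq> (\<Union>c\<in>C. mball_of m c u)"
    using covering_number_attained[OF assms(1,2)] by auto
  have "mspace m \<subseteq> (\<Union>c\<in>C. mball_of m c v)"
    using C(4) assms(3) by (auto simp: subset_iff) (meson less_le_trans)
  then show ?thesis
    unfolding covering_number_def[of m v] using C(1-3) by (intro Least_le) blast
qed

lemma covering_number_ge_1:
  assumes "totally_bounded_metric m" "u > 0" "mspace m \<noteq> {}"
  shows "1 \<le> covering_number m u"
proof -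
  obtain C where C: "finite C" "card C = covering_number m u" "mspace m \<subseteq> (\<Union>c\<in>C. mball_of m c u)"
    using covering_number_attained[OF assms(1,2)] by auto
  then have "C \<noteq> {}" using assms(3) by auto
  then show ?thesis using C by (metis One_nat_def Suc_leI card_gt_0_iff)
qed

text \<open>A lower sum of a decreasing integrand: on the interval \<open>I k\<close> from
  \<open>u (k + 2)\<close> to \<open>u (k + 1)\<close> the integrand is at least its value
  \<open>c k\<close> at the right end. The half-open intervals are disjoint and lie in
  \<open>{0..mdiam m}\<close>.\<close>

lemma dyadic_sum_le_dudley_integral:
  assumes tb: "totally_bounded_metric m" and ne: "mspace m \<noteq> {}" and D: "mdiam m > 0"
    and u: "u = (\<lambda>k. mdiam m / 2 ^ k)"
  shows "ennreal (\<Sum>k<K. (u (Suc k) - u (Suc (Suc k))) * sqrt (ln (covering_number m (u (Suc k)))))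
    \<le> dudley_integral m"
proof -
  define c where "c k = sqrt (ln (real (covering_number m (u (Suc k)))))" for k
  define I where "I k = {u (Suc (Suc k))..<u (Suc k)}" for k
  have u_pos: "u k > 0" for k using D by (simp add: u)
  have u_anti: "u j \<le> u k" if "k \<le> j" for j k
    using D that by (auto simp: u intro!: divide_left_mono power_increasing)
  have c_nonneg: "c k \<ge> 0" for k
    using covering_number_ge_1[OF tb u_pos ne] by (auto simp: c_def)
  have "ennreal (\<Sum>k<K. (u (Suc k) - u (Suc (Suc k))) * c k) =
      (\<Sum>k<K. ennreal (c k) * emeasure lborel (I k))"
    using u_anti c_nonneg
    by (subst sum_ennreal[symmetric])
       (auto intro!: sum.cong mult_nonneg_nonneg simp: I_def ennreal_mult mult.commute)
  also have "\<dots> = (\<Sum>k<K. (\<integral>\<^sup>+v. ennreal (c k) * indicator (I k) v \<partial>lborel))"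
    by (intro sum.cong refl nn_integral_cmult_indicator[symmetric]) (auto simp: I_def)
  also have "\<dots> = (\<integral>\<^sup>+v. (\<Sum>k<K. ennreal (c k) * indicator (I k) v) \<partial>lborel)"
    by (intro nn_integral_sum[symmetric]) (auto simp: I_def)
  also have "\<dots> \<le> dudley_integral m"
    unfolding dudley_integral_def
  proof (rule nn_integral_mono)
    fix v :: real
    show "(\<Sum>k<K. ennreal (c k) * indicator (I k) v)
      \<le> ennreal (sqrt (ln (real (covering_number m v)))) * indicator {0..mdiam m} v"
    proof (cases "\<exists>k<K. v \<in> I k")
      case False
      then have "(\<Sum>k<K. ennreal (c k) * indicator (I k) v) = 0"
        by (intro sum.neutral) auto
      then show ?thesis by simp
    next
      case True
      then obtain k where k: "k < K" "v \<in> I k" by auto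
      have "v \<notin> I j" if "j \<noteq> k" for j
      proof (cases "j < k")
        case True
        then have "u (Suc k) \<le> u (Suc (Suc j))" by (intro u_anti) simp
        then show ?thesis using k by (auto simp: I_def)
      next
        case False
        then have "u (Suc j) \<le> u (Suc (Suc k))" using that by (intro u_anti) simp
        then show ?thesis using k by (auto simp: I_def)
      qed
      then have "(\<Sum>k\<in>{..<K} - {k}. ennreal (c k) * indicator (I k) v) = 0"
        by (intro sum.neutral) auto
      then have "(\<Sum>k<K. ennreal (c k) * indicator (I k) v) = ennreal (c k)"
        using k by (subst sum.remove[of _ k]) auto
      also have "\<dots> \<le> ennreal (sqrt (ln (real (covering_number m v))))"
      proof -
        have v: "0 < v" "v \<le> u (Suc k)"
          using k u_pos[of "Suc (Suc k)"] by (auto simp: I_def)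
        have "c k \<le> sqrt (ln (real (covering_number m v)))"
          unfolding c_def
          using covering_number_antimono[OF tb v] covering_number_ge_1[OF tb u_pos ne, of "Suc k"]
          by (intro real_sqrt_le_mono) auto
        then show ?thesis by (rule ennreal_leI)
      qed
      also have "\<dots> = ennreal (sqrt (ln (real (covering_number m v)))) * indicator {0..mdiam m} v"
      proof -
        have "u (Suc k) \<le> u 0" by (intro u_anti) simp
        then have "v \<in> {0..mdiam m}"
          using k u_pos[of "Suc (Suc k)"] by (auto simp: I_def) (auto simp: u)
        then show ?thesis by simp
      qed
      finally show ?thesis .
    qed
  qed
  finally show ?thesis by (simp add: c_def)
qed

text \<open>
  One-sided maxima of centred increments are used because their expectation is bounded by a
  multiple of \<open>sqrt (ln n)\<close> for \<open>n\<close> variables also when \<open>n = 1\<close>, which the two-sided maximum is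
  not. The two sides are recombined in the diameter of the range of the process.
\<close>

lemma (in prob_space) chaining:
  fixes m :: "'b metric" and Z :: "'b \<Rightarrow> 'a \<Rightarrow> real"
  assumes tb: "totally_bounded_metric m" and ne: "mspace m \<noteq> {}" and D: "mdiam m > 0"
    and "0 \<le> \<sigma>"
    and int: "\<And>t. t \<in> mspace m \<Longrightarrow> integrable M (Z t)"
    and mgf: "\<And>s t l. s \<in> mspace m \<Longrightarrow> t \<in> mspace m \<Longrightarrow> l > 0 \<Longrightarrow>
      (\<integral>\<^sup>+x. ennreal (exp (l * (Z s x - Z t x))) \<partial>M) \<le> ennreal (exp (l\<^sup>2 * (\<sigma> * mdist m s t)\<^sup>2 / 2))"
    and u: "u = (\<lambda>k. mdiam m / 2 ^ k)"
  shows "\<exists>T W. finite T \<and> T \<noteq> {} \<and> T \<subseteq> mspace m \<and> (\<forall>t\<in>mspace m. \<exists>s\<in>T. mdist m s t \<le> u K) \<and>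
    integrable M W \<and> (\<forall>s\<in>T. \<forall>t\<in>T. \<forall>\<omega>. \<bar>Z s \<omega> - Z t \<omega>\<bar> \<le> W \<omega>) \<and>
    expectation W \<le> 12 * \<sigma> *
      (\<Sum>k<K. (u (Suc k) - u (Suc (Suc k))) * sqrt (ln (covering_number m (u (Suc k)))))"
proof -
  have u_pos: "u k > 0" for k using D by (simp add: u)
  obtain t0 where t0: "t0 \<in> mspace m" using ne by auto
  obtain Cov where Cov: "\<And>v. v > 0 \<Longrightarrow> Cov v \<subseteq> mspace m \<and> finite (Cov v) \<and>
      card (Cov v) = covering_number m v \<and> mspace m \<subseteq> (\<Union>c\<in>Cov v. mball_of m c v)"
    using covering_number_attained[OF tb] by metis
  \<comment> \<open>Level 0 is a single point, so all chains end in the same \<open>t0\<close>. It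
    is within \<open>u 0\<close>, the diameter, of every point, although an open ball of that radius
    about it might not cover the space.\<close>
  define T where "T k = (case k of 0 \<Rightarrow> {t0} | Suc j \<Rightarrow> Cov (u k))" for k
  have T_simps: "T 0 = {t0}" "T (Suc k) = Cov (u (Suc k))" for k by (simp_all add: T_def)
  have T: "T k \<subseteq> mspace m" "finite (T k)" "\<exists>p\<in>T k. mdist m p s \<le> u k"
    if "s \<in> mspace m" for k s
  proof -
    show "T k \<subseteq> mspace m" "finite (T k)"
      using t0 Cov[OF u_pos] by (auto simp: T_def split: nat.splits)
    show "\<exists>p\<in>T k. mdist m p s \<le> u k"
    proof (cases k)
      case 0
      then show ?thesis using mdist_le_mdiam[OF tb t0 that] by (simp add: T_simps u)
    next
      case (Suc j)
      have "s \<in> (\<Union>c\<in>Cov (u k). mball_of m c (u k))"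
        using Cov[OF u_pos[of k]] that by blast
      then obtain c where "c \<in> Cov (u k)" "s \<in> mball_of m c (u k)" by blast
      then show ?thesis using Suc by (auto simp: T_simps intro: less_imp_le)
    qed
  qed
  note T_sub = T(1)[OF t0] and T_fin = T(2)[OF t0]
  have T_ne: "T k \<noteq> {}" for k using T(3)[OF t0] by auto
  define P where "P k s = (SOME p. p \<in> T k \<and> mdist m p s \<le> u k)" for k s
  have P: "P k s \<in> T k \<and> mdist m (P k s) s \<le> u k" if "s \<in> mspace m" for k s
    unfolding P_def by (rule someI_ex) (use T(3)[OF that, of k] in blast)
  \<comment> \<open>The predecessor \<open>P k s\<close> depends on \<open>s\<close> alone, so level
    \<open>k\<close> contributes only as many increments as \<open>T (Suc k)\<close> has points, and
    each increment spans a distance of at most \<open>u k\<close>.\<close>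
  define A where "A k \<omega> = Max ((\<lambda>s. Z s \<omega> - Z (P k s) \<omega>) ` T (Suc k))" for k \<omega>
  define B where "B k \<omega> = Max ((\<lambda>s. Z (P k s) \<omega> - Z s \<omega>) ` T (Suc k))" for k \<omega>
  have P_in: "P k s \<in> mspace m" if "s \<in> mspace m" for k s using P T_sub that by blast
  have T_in: "s \<in> mspace m" if "s \<in> T k" for k s using T_sub that by blast
  have A_ge: "Z s \<omega> - Z (P k s) \<omega> \<le> A k \<omega>" and B_ge: "Z (P k s) \<omega> - Z s \<omega> \<le> B k \<omega>"
    if "s \<in> T (Suc k)" for s k \<omega>
    unfolding A_def B_def using that T_fin by (auto intro!: Max_ge)
  have A_int: "integrable M (A k)" and B_int: "integrable M (B k)" for k
    unfolding A_def B_def using T_fin T_ne T_in[of _ "Suc k"]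
    by (auto intro!: integrable_Max_image Bochner_Integration.integrable_diff int P_in)
  have chainA: "Z t \<omega> - Z t0 \<omega> \<le> (\<Sum>k<j. A k \<omega>)" if "t \<in> T j" for t j \<omega>
    using that
  proof (induction j arbitrary: t)
    case (Suc j)
    have "Z (P j t) \<omega> - Z t0 \<omega> \<le> (\<Sum>k<j. A k \<omega>)"
      using Suc.IH P T_in[OF Suc.prems] by blast
    then show ?case using A_ge[OF Suc.prems, of \<omega>] by simp
  qed (simp add: T_simps)
  have chainB: "Z t0 \<omega> - Z t \<omega> \<le> (\<Sum>k<j. B k \<omega>)" if "t \<in> T j" for t j \<omega>
    using that
  proof (induction j arbitrary: t)
    case (Suc j)
    have "Z t0 \<omega> - Z (P j t) \<omega> \<le> (\<Sum>k<j. B k \<omega>)"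
      using Suc.IH P T_in[OF Suc.prems] by blast
    then show ?case using B_ge[OF Suc.prems, of \<omega>] by simp
  qed (simp add: T_simps)
  define W where "W \<omega> = (\<Sum>k<K. A k \<omega>) + (\<Sum>k<K. B k \<omega>)" for \<omega>
  define n where "n k = ln (real (covering_number m (u (Suc k))))" for k
  have n_nonneg: "n k \<ge> 0" for k
    using covering_number_ge_1[OF tb u_pos ne] by (auto simp: n_def)
  \<comment> \<open>The factor 6 is 3/2 times 4: \<open>sqrt 2\<close> is at most 3/2, and
    \<open>u k\<close> is four times the length of the interval that carries level \<open>k\<close>
    in the lower sum. The two sides \<open>A\<close> and \<open>B\<close> then give 12.\<close>
  have link: "sqrt (2 * (\<sigma> * u k)\<^sup>2 * n k) \<le> 6 * \<sigma> * ((u (Suc k) - u (Suc (Suc k))) * sqrt (n k))" for k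
  proof -
    have "sqrt (2 * (\<sigma> * u k)\<^sup>2 * n k) = sqrt 2 * (\<sigma> * u k) * sqrt (n k)"
      using \<open>0 \<le> \<sigma>\<close> less_imp_le[OF u_pos] by (simp add: real_sqrt_mult)
    also have "\<dots> \<le> (3/2) * (\<sigma> * u k) * sqrt (n k)"
      using \<open>0 \<le> \<sigma>\<close> less_imp_le[OF u_pos] n_nonneg
      by (intro mult_right_mono real_le_lsqrt) (auto simp: power2_eq_square)
    also have "\<dots> = 6 * \<sigma> * ((u (Suc k) - u (Suc (Suc k))) * sqrt (n k))"
      by (simp add: u)
    finally show ?thesis .
  qed
  have step: "(\<integral>\<^sup>+x. ennreal (exp (l * (Z s x - Z t x))) \<partial>M) \<le> ennreal (exp (l\<^sup>2 * (\<sigma> * u k)\<^sup>2 / 2))"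
    if "s \<in> mspace m" "t \<in> mspace m" "mdist m s t \<le> u k" "l > 0" for s t k l
  proof -
    have "(\<sigma> * mdist m s t)\<^sup>2 \<le> (\<sigma> * u k)\<^sup>2"
      using that \<open>0 \<le> \<sigma>\<close> by (intro power_mono mult_left_mono) auto
    then have "exp (l\<^sup>2 * (\<sigma> * mdist m s t)\<^sup>2 / 2) \<le> exp (l\<^sup>2 * (\<sigma> * u k)\<^sup>2 / 2)"
      by (simp add: mult_left_mono)
    with mgf[OF that(1,2,4)] show ?thesis
      by (meson ennreal_leI order_trans)
  qed
  have card_T: "ln (real (card (T (Suc k)))) = n k" for k
    using Cov[OF u_pos[of "Suc k"]] by (simp add: T_simps n_def)
  have EA: "expectation (A k) \<le> sqrt (2 * (\<sigma> * u k)\<^sup>2 * n k)" for k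
    unfolding A_def card_T[symmetric]
  proof (rule expectation_Max_le)
    fix s assume s: "s \<in> T (Suc k)"
    show "integrable M (\<lambda>\<omega>. Z s \<omega> - Z (P k s) \<omega>)"
      by (intro Bochner_Integration.integrable_diff int P_in T_in[OF s])
    show "(\<integral>\<^sup>+x. ennreal (exp (l * (Z s x - Z (P k s) x))) \<partial>M) \<le> ennreal (exp (l\<^sup>2 * (\<sigma> * u k)\<^sup>2 / 2))"
      if "l > 0" for l
      using P[OF T_in[OF s], of k] that by (intro step T_in[OF s] P_in) (auto simp: mdist_commute)
  qed (use T_fin T_ne in auto)
  have EB: "expectation (B k) \<le> sqrt (2 * (\<sigma> * u k)\<^sup>2 * n k)" for k
    unfolding B_def card_T[symmetric]
  proof (rule expectation_Max_le)
    fix s assume s: "s \<in> T (Suc k)"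
    show "integrable M (\<lambda>\<omega>. Z (P k s) \<omega> - Z s \<omega>)"
      by (intro Bochner_Integration.integrable_diff int P_in T_in[OF s])
    show "(\<integral>\<^sup>+x. ennreal (exp (l * (Z (P k s) x - Z s x))) \<partial>M) \<le> ennreal (exp (l\<^sup>2 * (\<sigma> * u k)\<^sup>2 / 2))"
      if "l > 0" for l
      using P[OF T_in[OF s], of k] that by (intro step T_in[OF s] P_in) auto
  qed (use T_fin T_ne in auto)
  have "expectation W = (\<Sum>k<K. expectation (A k)) + (\<Sum>k<K. expectation (B k))"
    unfolding W_def using A_int B_int by simp
  also have "\<dots> \<le> (\<Sum>k<K. 6 * \<sigma> * ((u (Suc k) - u (Suc (Suc k))) * sqrt (n k))) +
      (\<Sum>k<K. 6 * \<sigma> * ((u (Suc k) - u (Suc (Suc k))) * sqrt (n k)))"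
    using order_trans[OF EA link] order_trans[OF EB link] by (intro add_mono sum_mono)
  also have "\<dots> = 12 * \<sigma> * (\<Sum>k<K. (u (Suc k) - u (Suc (Suc k))) * sqrt (n k))"
    by (simp add: sum_distrib_left[symmetric])
  finally have EW: "expectation W \<le> 12 * \<sigma> * (\<Sum>k<K. (u (Suc k) - u (Suc (Suc k))) * sqrt (n k))" .
  have "\<bar>Z s \<omega> - Z t \<omega>\<bar> \<le> W \<omega>" if "s \<in> T K" "t \<in> T K" for s t \<omega>
    using chainA[OF that(1), of \<omega>] chainB[OF that(1), of \<omega>] chainA[OF that(2), of \<omega>]
      chainB[OF that(2), of \<omega>]
    unfolding W_def by linarith
  moreover have "integrable M W" unfolding W_def using A_int B_int by simp
  moreover have "\<forall>t\<in>mspace m. \<exists>s\<in>T K. mdist m s t \<le> u K" by (intro ballI T(3))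
  ultimately show ?thesis
    by (intro exI[of _ "T K"] exI[of _ W] conjI ballI allI T_fin T_ne T_sub EW[unfolded n_def]) blast+
qed

text \<open>The bound on the expectation of \<open>W\<close> does not depend on
  \<open>\<epsilon>\<close>, so the net may be taken as fine as the discretisation error demands.
  Diameter zero is separate because all dyadic radii vanish; there one point is a net and
  \<open>W = 0\<close> works.\<close>

lemma (in prob_space) dudley:
  fixes m :: "'b metric" and Z :: "'b \<Rightarrow> 'a \<Rightarrow> real"
  assumes tb: "totally_bounded_metric m" and ne: "mspace m \<noteq> {}"
    and "0 \<le> \<sigma>" "0 < \<epsilon>"
    and int: "\<And>t. t \<in> mspace m \<Longrightarrow> integrable M (Z t)"
    and mgf: "\<And>s t l. s \<in> mspace m \<Longrightarrow> t \<in> mspace m \<Longrightarrow> l > 0 \<Longrightarrow>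
      (\<integral>\<^sup>+x. ennreal (exp (l * (Z s x - Z t x))) \<partial>M) \<le> ennreal (exp (l\<^sup>2 * (\<sigma> * mdist m s t)\<^sup>2 / 2))"
  shows "\<exists>T W. finite T \<and> T \<noteq> {} \<and> T \<subseteq> mspace m \<and> (\<forall>t\<in>mspace m. \<exists>s\<in>T. mdist m s t \<le> \<epsilon>) \<and>
    integrable M W \<and> (\<forall>s\<in>T. \<forall>t\<in>T. \<forall>\<omega>. \<bar>Z s \<omega> - Z t \<omega>\<bar> \<le> W \<omega>) \<and>
    ennreal (expectation W) \<le> ennreal (12 * \<sigma>) * dudley_integral m"
proof (cases "mdiam m > 0")
  case True
  obtain K where K: "mdiam m / 2 ^ K < \<epsilon>"
  proof -
    obtain K where "(1/2) ^ K < \<epsilon> / mdiam m"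
      using real_arch_pow_inv[of "\<epsilon> / mdiam m" "1/2"] True \<open>0 < \<epsilon>\<close> by auto
    then show ?thesis using True that[of K] by (simp add: field_simps)
  qed
  let ?u = "\<lambda>k. mdiam m / 2 ^ k"
  let ?S = "\<Sum>k<K. (?u (Suc k) - ?u (Suc (Suc k))) * sqrt (ln (covering_number m (?u (Suc k))))"
  obtain T W where TW: "finite T" "T \<noteq> {}" "T \<subseteq> mspace m"
    "\<forall>t\<in>mspace m. \<exists>s\<in>T. mdist m s t \<le> ?u K" "integrable M W"
    "\<forall>s\<in>T. \<forall>t\<in>T. \<forall>\<omega>. \<bar>Z s \<omega> - Z t \<omega>\<bar> \<le> W \<omega>" "expectation W \<le> 12 * \<sigma> * ?S"
  proof -
    have "\<exists>T W. finite T \<and> T \<noteq> {} \<and> T \<subseteq> mspace m \<and> (\<forall>t\<in>mspace m. \<exists>s\<in>T. mdist m s t \<le> ?u K) \<and>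
        integrable M W \<and> (\<forall>s\<in>T. \<forall>t\<in>T. \<forall>\<omega>. \<bar>Z s \<omega> - Z t \<omega>\<bar> \<le> W \<omega>) \<and>
        expectation W \<le> 12 * \<sigma> * ?S"
      by (rule chaining[OF tb ne True \<open>0 \<le> \<sigma>\<close> int mgf refl])
    then show ?thesis by (elim exE conjE) (rule that)
  qed
  have "ennreal (expectation W) \<le> ennreal (12 * \<sigma>) * ennreal ?S"
    using TW(7) \<open>0 \<le> \<sigma>\<close> by (subst ennreal_mult'[symmetric]) (auto intro: ennreal_leI)
  also have "\<dots> \<le> ennreal (12 * \<sigma>) * dudley_integral m"
    using dyadic_sum_le_dudley_integral[OF tb ne True refl] by (intro mult_left_mono) auto
  finally have "ennreal (expectation W) \<le> ennreal (12 * \<sigma>) * dudley_integral m" .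
  moreover have "\<forall>t\<in>mspace m. \<exists>s\<in>T. mdist m s t \<le> \<epsilon>"
    using TW(4) K by (meson less_imp_le order_trans)
  ultimately show ?thesis using TW by (intro exI[of _ T] exI[of _ W] conjI)
next
  case False
  obtain t0 where t0: "t0 \<in> mspace m" using ne by auto
  have "mdist m t0 t \<le> \<epsilon>" if "t \<in> mspace m" for t
    using mdist_le_mdiam[OF tb t0 that] False \<open>0 < \<epsilon>\<close> by simp
  then show ?thesis using t0 by (intro exI[of _ "{t0}"] exI[of _ "\<lambda>_. 0"]) auto
qed

section \<open>Independent samples from a mixture\<close>

text \<open>The locale of product probability spaces wants a probability measure at every index, but
  the families here are controlled only on \<open>I\<close>. A point mass is put at the other
  indices, which leaves \<open>PiM I\<close> unchanged. The next two lemmas use the same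
  padding.\<close>

lemma emeasure_PiM_PiE_prob_space:
  assumes "finite I" "\<And>i. i \<in> I \<Longrightarrow> prob_space (M i)" "\<And>i. i \<in> I \<Longrightarrow> A i \<in> sets (M i)"
  shows "emeasure (PiM I M) (Pi\<^sub>E I A) = (\<Prod>i\<in>I. emeasure (M i) (A i))"
proof -
  define N where "N i = (if i \<in> I then M i else return (count_space UNIV) undefined)" for i
  interpret product_prob_space N
    by (rule product_prob_spaceI) (auto simp: N_def intro!: prob_space_return assms)
  have "PiM I M = PiM I N" by (intro PiM_cong) (simp_all add: N_def)
  moreover have "emeasure (PiM I N) (Pi\<^sub>E I A) = (\<Prod>i\<in>I. emeasure (N i) (A i))"
    using assms by (intro emeasure_PiM) (auto simp: N_def)
  ultimately show ?thesis by (simp add: N_def)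
qed

lemma nn_integral_PiM_prod_prob_space:
  assumes "finite I" "\<And>i. i \<in> I \<Longrightarrow> prob_space (M i)" "\<And>i. i \<in> I \<Longrightarrow> f i \<in> borel_measurable (M i)"
  shows "(\<integral>\<^sup>+x. (\<Prod>i\<in>I. f i (x i)) \<partial>PiM I M) = (\<Prod>i\<in>I. integral\<^sup>N (M i) (f i))"
proof -
  define N where "N i = (if i \<in> I then M i else return (count_space UNIV) undefined)" for i
  interpret product_prob_space N
    by (rule product_prob_spaceI) (auto simp: N_def intro!: prob_space_return assms)
  have "PiM I M = PiM I N" by (intro PiM_cong) (simp_all add: N_def)
  moreover have "(\<integral>\<^sup>+x. (\<Prod>i\<in>I. f i (x i)) \<partial>PiM I N) = (\<Prod>i\<in>I. integral\<^sup>N (N i) (f i))"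
    using assms by (intro product_nn_integral_prod) (auto simp: N_def)
  ultimately show ?thesis by (simp add: N_def)
qed

lemma PiM_eqI_prob_space:
  assumes "finite I" "\<And>i. i \<in> I \<Longrightarrow> prob_space (M i)" "sets P = sets (PiM I M)"
    and "\<And>A. (\<And>i. i \<in> I \<Longrightarrow> A i \<in> sets (M i)) \<Longrightarrow>
      emeasure P (Pi\<^sub>E I A) = (\<Prod>i\<in>I. emeasure (M i) (A i))"
  shows "P = PiM I M"
proof -
  define N where "N i = (if i \<in> I then M i else return (count_space UNIV) undefined)" for i
  interpret product_prob_space N
    by (rule product_prob_spaceI) (auto simp: N_def intro!: prob_space_return assms)
  have eq: "PiM I M = PiM I N" by (intro PiM_cong) (simp_all add: N_def)
  have "P = PiM I N"
    using assms(1,3,4) eq by (intro PiM_eqI) (auto simp: N_def)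
  with eq show ?thesis by simp
qed

text \<open>It suffices to test boxes, which generate the product and are closed under intersection;
  there the measure is a finite product of measurable functions of \<open>s\<close>.\<close>

lemma measurable_PiM_kernel:
  assumes "finite I" "\<And>i. i \<in> I \<Longrightarrow> (\<lambda>s. K s i) \<in> M \<rightarrow>\<^sub>M prob_algebra N"
  shows "(\<lambda>s. PiM I (K s)) \<in> M \<rightarrow>\<^sub>M prob_algebra (\<Pi>\<^sub>M i\<in>I. N)"
proof (rule measurable_prob_algebra_generated)
  have K: "prob_space (K s i)" "sets (K s i) = sets N" if "s \<in> space M" "i \<in> I" for s i
    using measurable_space[OF assms(2)[OF that(2)] that(1)] by (auto simp: space_prob_algebra)
  show "sets (\<Pi>\<^sub>M i\<in>I. N) = sigma_sets (\<Pi>\<^sub>E i\<in>I. space N) (prod_algebra I (\<lambda>_. N))"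
    by (rule sets_PiM)
  show "Int_stable (prod_algebra I (\<lambda>_. N))" by (rule Int_stable_prod_algebra)
  show "prod_algebra I (\<lambda>_. N) \<subseteq> Pow (\<Pi>\<^sub>E i\<in>I. space N)" by (rule prod_algebra_sets_into_space)
  show "prob_space (PiM I (K s))" if "s \<in> space M" for s
    using K that by (intro prob_space_PiM) auto
  show "sets (PiM I (K s)) = sets (\<Pi>\<^sub>M i\<in>I. N)" if "s \<in> space M" for s
    using K that by (intro sets_PiM_cong) auto
  fix A assume "A \<in> prod_algebra I (\<lambda>_. N)"
  then obtain X where X: "A = Pi\<^sub>E I X" "\<And>i. i \<in> I \<Longrightarrow> X i \<in> sets N"
    unfolding prod_algebra_eq_finite[OF assms(1)] by auto
  have "(\<lambda>s. emeasure (K s i) (X i)) \<in> borel_measurable M" if "i \<in> I" for i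
    using measurable_prob_algebraD[OF assms(2)[OF that]] X(2)[OF that]
    by (rule measurable_compose[OF _ measurable_emeasure_subprob_algebra])
  then have "(\<lambda>s. \<Prod>i\<in>I. emeasure (K s i) (X i)) \<in> borel_measurable M"
    by (intro borel_measurable_prod_ennreal)
  then show "(\<lambda>s. emeasure (PiM I (K s)) A) \<in> borel_measurable M"
    by (rule measurable_cong[THEN iffD1, rotated])
      (simp add: X K emeasure_PiM_PiE_prob_space[OF assms(1)])
qed

text \<open>Conditioning on all first coordinates at once, without conditional expectations: the
  product of the joint laws \<open>\<nu>\<close> is the product of the marginals
  \<open>\<mu>\<close> followed by the product of the kernels. A bound on the inner integral that is
  uniform in the first coordinates then survives averaging.\<close>

lemma nn_integral_PiM_disintegrate_le:
  assumes I: "finite I" and K: "K \<in> M \<rightarrow>\<^sub>M prob_algebra N"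
    and \<mu>: "\<mu> \<in> space (prob_algebra M)" and \<nu>: "\<nu> \<in> space (prob_algebra (M \<Otimes>\<^sub>M N))"
    and dis: "\<And>B. B \<in> sets (M \<Otimes>\<^sub>M N) \<Longrightarrow> emeasure \<nu> B = (\<integral>\<^sup>+x. emeasure (K x) (Pair x -` B) \<partial>\<mu>)"
    and f: "f \<in> borel_measurable (\<Pi>\<^sub>M i\<in>I. M \<Otimes>\<^sub>M N)"
    and le: "\<And>s. s \<in> space (\<Pi>\<^sub>M i\<in>I. M) \<Longrightarrow>
      (\<integral>\<^sup>+y. f (\<lambda>i\<in>I. (s i, y i)) \<partial>PiM I (\<lambda>i. K (s i))) \<le> c"
  shows "(\<integral>\<^sup>+z. f z \<partial>PiM I (\<lambda>_. \<nu>)) \<le> c"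
proof -
  have [simp]: "prob_space \<mu>" "sets \<mu> = sets M" "prob_space \<nu>" "sets \<nu> = sets (M \<Otimes>\<^sub>M N)"
    using \<mu> \<nu> by (auto simp: space_prob_algebra)
  have [measurable_cong]: "sets \<mu> = sets M" by simp
  have Kp: "prob_space (K x)" "sets (K x) = sets N" if "x \<in> space M" for x
    using measurable_space[OF K that] by (auto simp: space_prob_algebra)
  note [measurable] = K
  have PK[measurable]: "(\<lambda>s. PiM I (\<lambda>i. K (s i))) \<in> (\<Pi>\<^sub>M i\<in>I. M) \<rightarrow>\<^sub>M prob_algebra (\<Pi>\<^sub>M i\<in>I. N)"
    using I by (rule measurable_PiM_kernel) measurable
  define \<kappa> where "\<kappa> s = distr (PiM I (\<lambda>i. K (s i))) (\<Pi>\<^sub>M i\<in>I. M \<Otimes>\<^sub>M N) (\<lambda>y. \<lambda>i\<in>I. (s i, y i))" for s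
  have \<kappa>: "\<kappa> \<in> (\<Pi>\<^sub>M i\<in>I. M) \<rightarrow>\<^sub>M prob_algebra (\<Pi>\<^sub>M i\<in>I. M \<Otimes>\<^sub>M N)"
    unfolding \<kappa>_def by measurable
  let ?P = "\<Pi>\<^sub>M i\<in>I. \<mu>"
  have P: "?P \<in> space (prob_algebra (\<Pi>\<^sub>M i\<in>I. M))"
    by (auto simp: space_prob_algebra intro!: prob_space_PiM sets_PiM_cong)
  have spaceP: "space ?P = space (\<Pi>\<^sub>M i\<in>I. M)"
    by (intro sets_eq_imp_space_eq sets_PiM_cong) auto
  have pair: "(\<lambda>y. \<lambda>i\<in>I. (s i, y i)) \<in> PiM I (\<lambda>i. K (s i)) \<rightarrow>\<^sub>M (\<Pi>\<^sub>M i\<in>I. M \<Otimes>\<^sub>M N)"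
    if s: "s \<in> space (\<Pi>\<^sub>M i\<in>I. M)" for s
  proof -
    have "sets (PiM I (\<lambda>i. K (s i))) = sets (\<Pi>\<^sub>M i\<in>I. N)"
      using s Kp by (intro sets_PiM_cong) (auto simp: space_PiM PiE_iff)
    moreover have "(\<lambda>y. \<lambda>i\<in>I. (s i, y i)) \<in> (\<Pi>\<^sub>M i\<in>I. N) \<rightarrow>\<^sub>M (\<Pi>\<^sub>M i\<in>I. M \<Otimes>\<^sub>M N)"
      using s by (intro measurable_restrict measurable_Pair measurable_const
          measurable_component_singleton) (auto simp: space_PiM PiE_iff)
    ultimately show ?thesis by (simp cong: measurable_cong_sets)
  qed
  \<comment> \<open>Both sides are compared on boxes. The kernel \<open>\<kappa>\<close> gives a box
    a product over \<open>i\<close> of functions of \<open>s i\<close>, so the integral over the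
    independent \<open>s i\<close> factorises, and \<open>dis\<close> turns each factor into a value
    of \<open>\<nu>\<close>.\<close>
  have bind: "?P \<bind> \<kappa> = (\<Pi>\<^sub>M i\<in>I. \<nu>)"
  proof (rule PiM_eqI_prob_space[OF I])
    show "sets (?P \<bind> \<kappa>) = sets (\<Pi>\<^sub>M i\<in>I. \<nu>)"
      by (subst sets_bind'[OF P \<kappa>]) (auto intro!: sets_PiM_cong)
    fix A assume "\<And>i. i \<in> I \<Longrightarrow> A i \<in> sets \<nu>"
    then have A[measurable]: "A i \<in> sets (M \<Otimes>\<^sub>M N)" if "i \<in> I" for i using that by simp
    then have A_PiE: "Pi\<^sub>E I A \<in> sets (\<Pi>\<^sub>M i\<in>I. M \<Otimes>\<^sub>M N)" using I by (intro sets_PiM_I_finite) auto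
    have box: "emeasure (\<kappa> s) (Pi\<^sub>E I A) = (\<Prod>i\<in>I. emeasure (K (s i)) (Pair (s i) -` A i))"
      if s: "s \<in> space (\<Pi>\<^sub>M i\<in>I. M)" for s
    proof -
      have si: "s i \<in> space M" if "i \<in> I" for i using s that by (auto simp: space_PiM PiE_iff)
      have "(\<lambda>y. \<lambda>i\<in>I. (s i, y i)) -` Pi\<^sub>E I A \<inter> space (PiM I (\<lambda>i. K (s i))) =
          Pi\<^sub>E I (\<lambda>i. Pair (s i) -` A i)"
        using sets.sets_into_space[OF A] si sets_eq_imp_space_eq[OF Kp(2)[OF si]]
        by (auto simp: space_PiM PiE_iff space_pair_measure) blast
      then have "emeasure (\<kappa> s) (Pi\<^sub>E I A) =
          emeasure (PiM I (\<lambda>i. K (s i))) (Pi\<^sub>E I (\<lambda>i. Pair (s i) -` A i))"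
        unfolding \<kappa>_def using A_PiE pair[OF s] by (subst emeasure_distr) auto
      also have "\<dots> = (\<Prod>i\<in>I. emeasure (K (s i)) (Pair (s i) -` A i))"
        using Kp si by (intro emeasure_PiM_PiE_prob_space I) (auto intro: sets_Pair1[OF A])
      finally show ?thesis .
    qed
    have meas: "(\<lambda>x. emeasure (K x) (Pair x -` A i)) \<in> borel_measurable \<mu>" if "i \<in> I" for i
    proof -
      have "(\<lambda>x. \<integral>\<^sup>+y. indicator (A i) (x, y) \<partial>K x) \<in> borel_measurable M"
        using that A by (intro nn_integral_measurable_subprob_algebra2[of _ M N] measurable_prob_algebraD[OF K])
          (simp add: case_prod_beta')
      moreover have "(\<integral>\<^sup>+y. indicator (A i) (x, y) \<partial>K x) = emeasure (K x) (Pair x -` A i)"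
        if "x \<in> space M" for x
      proof -
        have "(\<integral>\<^sup>+y. indicator (A i) (x, y) \<partial>K x) = (\<integral>\<^sup>+y. indicator (Pair x -` A i) y \<partial>K x)"
          by (intro nn_integral_cong) (auto simp: indicator_def)
        also have "\<dots> = emeasure (K x) (Pair x -` A i)"
          using Kp[OF that] sets_Pair1[OF A[OF \<open>i \<in> I\<close>]] by (intro nn_integral_indicator) auto
        finally show ?thesis .
      qed
      ultimately show ?thesis by (simp cong: measurable_cong measurable_cong_sets)
    qed
    have "emeasure (?P \<bind> \<kappa>) (Pi\<^sub>E I A) = (\<integral>\<^sup>+s. emeasure (\<kappa> s) (Pi\<^sub>E I A) \<partial>?P)"
      by (rule emeasure_bind_prob_algebra[OF P \<kappa> A_PiE])
    also have "\<dots> = (\<integral>\<^sup>+s. (\<Prod>i\<in>I. emeasure (K (s i)) (Pair (s i) -` A i)) \<partial>?P)"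
      by (intro nn_integral_cong box) (simp add: spaceP)
    also have "\<dots> = (\<Prod>i\<in>I. \<integral>\<^sup>+x. emeasure (K x) (Pair x -` A i) \<partial>\<mu>)"
      using nn_integral_PiM_prod_prob_space[OF I, of "\<lambda>_. \<mu>" "\<lambda>i x. emeasure (K x) (Pair x -` A i)"] meas
      by simp
    also have "\<dots> = (\<Prod>i\<in>I. emeasure \<nu> (A i))"
      by (intro prod.cong refl dis[symmetric] A)
    finally show "emeasure (?P \<bind> \<kappa>) (Pi\<^sub>E I A) = (\<Prod>i\<in>I. emeasure \<nu> (A i))" .
  qed simp
  interpret P: prob_space ?P by (intro prob_space_PiM) simp
  have "(\<integral>\<^sup>+z. f z \<partial>PiM I (\<lambda>_. \<nu>)) = (\<integral>\<^sup>+s. \<integral>\<^sup>+z. f z \<partial>\<kappa> s \<partial>?P)"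
    unfolding bind[symmetric] using measurable_prob_algebraD[OF \<kappa>]
    by (intro nn_integral_bind[OF f]) (simp cong: measurable_cong_sets)
  also have "\<dots> = (\<integral>\<^sup>+s. \<integral>\<^sup>+y. f (\<lambda>i\<in>I. (s i, y i)) \<partial>PiM I (\<lambda>i. K (s i)) \<partial>?P)"
    unfolding \<kappa>_def using f pair by (intro nn_integral_cong nn_integral_distr) (auto simp: spaceP)
  also have "\<dots> \<le> (\<integral>\<^sup>+s. c \<partial>?P)"
    by (intro nn_integral_mono le) (simp add: spaceP)
  finally show ?thesis by (simp add: P.emeasure_space_1)
qed

text \<open>
  The weights \<open>1 / \<Sum>\<^sub>k q k\<close> make the sum of the \<open>g (y i) / (\<Sum>\<^sub>k q k (y i))\<close> an unbiased
  estimator of \<open>\<integral>g\<close>, since \<open>\<Sum>\<^sub>i q i / \<Sum>\<^sub>k q k = 1\<close>.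
\<close>

lemma mixture_estimator_mgf:
  fixes q :: "'i \<Rightarrow> 'a \<Rightarrow> real" and g :: "'a \<Rightarrow> real"
  assumes I: "finite I" "I \<noteq> {}" and "\<delta> > 0" "c \<ge> 0" "l > 0"
    and q[measurable]: "\<And>i. i \<in> I \<Longrightarrow> q i \<in> borel_measurable M"
    and q_ge: "\<And>i y. i \<in> I \<Longrightarrow> y \<in> space M \<Longrightarrow> \<delta> \<le> q i y"
    and prob: "\<And>i. i \<in> I \<Longrightarrow> prob_space (density M (\<lambda>y. ennreal (q i y)))"
    and g[measurable]: "g \<in> borel_measurable M"
    and g_le: "AE y in M. \<bar>g y\<bar> \<le> c"
  shows "(\<integral>\<^sup>+y. ennreal (exp (l * ((\<Sum>i\<in>I. g (y i) / (\<Sum>k\<in>I. q k (y i))) - (\<integral>y. g y \<partial>M))))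
      \<partial>PiM I (\<lambda>i. density M (\<lambda>y. ennreal (q i y))))
    \<le> ennreal (exp (l\<^sup>2 * (c\<^sup>2 / (\<delta>\<^sup>2 * real (card I))) / 2))"
proof -
  define n where "n = real (card I)"
  have n: "n > 0" using I by (simp add: n_def card_gt_0_iff)
  define Q where "Q y = (\<Sum>k\<in>I. q k y)" for y
  define X where "X y = g y / Q y" for y
  define K where "K i = density M (\<lambda>y. ennreal (q i y))" for i
  have [measurable]: "Q \<in> borel_measurable M" unfolding Q_def by measurable
  have X_meas[measurable]: "X \<in> borel_measurable M" unfolding X_def by measurable
  have Q_ge: "n * \<delta> \<le> Q y" if "y \<in> space M" for y
    using sum_bounded_below[of I \<delta> "\<lambda>k. q k y"] q_ge that by (simp add: Q_def n_def)
  have Q_pos: "Q y > 0" if "y \<in> space M" for y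
    using Q_ge[OF that] n \<open>\<delta> > 0\<close> by (meson less_le_trans mult_pos_pos)
  \<comment> \<open>Each summand is bounded by \<open>b\<close>, of order \<open>1 / n\<close>,
    because the mixture is at least \<open>n * \<delta>\<close>. The \<open>n\<close> variance
    proxies \<open>b\<^sup>2\<close> add up to \<open>c\<^sup>2 / (\<delta>\<^sup>2 * n)\<close>,
    the source of the rate \<open>1 / sqrt N\<close>.\<close>
  define b where "b = c / (n * \<delta>)"
  have X_le: "AE y in M. \<bar>X y\<bar> \<le> b"
    using g_le AE_space
  proof eventually_elim
    case (elim y)
    have "\<bar>X y\<bar> = \<bar>g y\<bar> / Q y" using Q_pos[of y] elim by (simp add: X_def)
    also have "\<dots> \<le> c / (n * \<delta>)"
      using Q_ge elim n \<open>\<delta> > 0\<close> \<open>c \<ge> 0\<close> by (intro frac_le) auto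
    finally show ?case by (simp add: b_def)
  qed
  have X_le_K: "AE y in K i. X y \<in> {-b..b}" if "i \<in> I" for i
  proof -
    have "AE y in K i. \<bar>X y\<bar> \<le> b"
      unfolding K_def using that X_le by (subst AE_density) auto
    then show ?thesis by eventually_elim auto
  qed
  have q_nonneg: "AE y in M. 0 \<le> q i y" if "i \<in> I" for i
  proof (rule AE_I2)
    fix y assume "y \<in> space M"
    then show "0 \<le> q i y" using q_ge[OF that, of y] \<open>\<delta> > 0\<close> by linarith
  qed
  \<comment> \<open>The \<open>y i\<close> have different laws, so the summands have different
    means. Each is centred at its own mean, and only the sum of the means has to be
    computed.\<close>
  define m where "m i = (\<integral>y. X y \<partial>K i)" for i
  have int: "integrable M (\<lambda>y. q i y * X y)" and m_eq: "m i = (\<integral>y. q i y * X y \<partial>M)" if "i \<in> I" for i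
  proof -
    interpret K: prob_space "K i" unfolding K_def by (rule prob[OF that])
    have "AE y in K i. norm (X y) \<le> b" using X_le_K[OF that] by eventually_elim auto
    then have "integrable (K i) X"
      by (rule K.integrable_const_bound) (simp add: K_def)
    then show "integrable M (\<lambda>y. q i y * X y)"
      unfolding K_def using that q_nonneg[OF that] by (subst (asm) integrable_density) auto
    show "m i = (\<integral>y. q i y * X y \<partial>M)"
      unfolding m_def K_def using that q_nonneg[OF that] by (subst integral_density) auto
  qed
  have "(\<Sum>i\<in>I. m i) = (\<integral>y. (\<Sum>i\<in>I. q i y * X y) \<partial>M)"
    using int m_eq by (simp cong: sum.cong)
  also have "\<dots> = (\<integral>y. g y \<partial>M)"
  proof (intro Bochner_Integration.integral_cong refl)
    fix y assume "y \<in> space M"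
    then have "Q y \<noteq> 0" using Q_pos by force
    moreover have "(\<Sum>i\<in>I. q i y * X y) = Q y * X y" by (simp add: Q_def sum_distrib_right)
    ultimately show "(\<Sum>i\<in>I. q i y * X y) = g y" by (simp add: X_def)
  qed
  finally have sum_m: "(\<Sum>i\<in>I. m i) = (\<integral>y. g y \<partial>M)" .
  \<comment> \<open>Hoeffding's lemma on an interval of length \<open>2 * b\<close>, where
    \<open>(2 * b)\<^sup>2 / 8 = b\<^sup>2 / 2\<close>.\<close>
  have one: "(\<integral>\<^sup>+y. ennreal (exp (l * (X y - m i))) \<partial>K i) \<le> ennreal (exp (l\<^sup>2 * b\<^sup>2 / 2))"
    if "i \<in> I" for i
  proof -
    interpret K: prob_space "K i" unfolding K_def by (rule prob[OF that])
    interpret X: interval_bounded_random_variable "K i" X "-b" b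
      by unfold_locales (use X_le_K[OF that] in \<open>auto simp: K_def\<close>)
    show ?thesis
      using X.Hoeffdings_lemma_nn_integral[OF \<open>l > 0\<close>]
      by (simp add: m_def power2_eq_square algebra_simps)
  qed
  have "(\<integral>\<^sup>+y. ennreal (exp (l * ((\<Sum>i\<in>I. X (y i)) - (\<integral>y. g y \<partial>M)))) \<partial>PiM I K) =
      (\<integral>\<^sup>+y. (\<Prod>i\<in>I. ennreal (exp (l * (X (y i) - m i)))) \<partial>PiM I K)"
    by (intro nn_integral_cong)
       (simp add: prod_ennreal exp_sum[OF I(1), symmetric] sum_m[symmetric] sum_subtractf[symmetric]
          sum_distrib_left)
  also have "\<dots> = (\<Prod>i\<in>I. \<integral>\<^sup>+y. ennreal (exp (l * (X y - m i))) \<partial>K i)"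
    using prob by (intro nn_integral_PiM_prod_prob_space I(1)) (auto simp: K_def)
  also have "\<dots> \<le> (\<Prod>i\<in>I. ennreal (exp (l\<^sup>2 * b\<^sup>2 / 2)))"
    by (intro prod_mono_ennreal one)
  also have "\<dots> = ennreal (exp (n * (l\<^sup>2 * b\<^sup>2 / 2)))"
    by (simp add: ennreal_power exp_of_nat_mult[symmetric] n_def)
  also have "n * (l\<^sup>2 * b\<^sup>2 / 2) = l\<^sup>2 * (c\<^sup>2 / (\<delta>\<^sup>2 * real (card I))) / 2"
    using n unfolding n_def[symmetric] b_def by (simp add: power_divide power_mult_distrib power2_eq_square mult_ac)
  finally show ?thesis by (simp add: X_def Q_def K_def)
qed

section \<open>The controlled process and its simulation\<close>

lemma space_state_leb:
  assumes "states D \<subseteq> extensional {..<state_dim D}"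
  shows "space (state_leb D) = states D"
  using assms by (auto simp: state_leb_def space_restrict_space space_PiM PiE_def)

lemma space_action_borel: "space (action_borel D) = actions D"
  unfolding action_borel_def using openin_subset[of "mtopology_of (action_metric D)"]
  by (subst space_measure_of) auto

lemma mspace_sum_metric: "mspace (sum_metric m1 m2) = mspace m1 \<times> mspace m2"
  and mdist_sum_metric: "mdist (sum_metric m1 m2) (x, a) (x', a') = mdist m1 x x' + mdist m2 a a'"
  using Metric_space.mspace_metric[OF Metric_space_sum[of m1 m2]]
    Metric_space.mdist_metric[OF Metric_space_sum[of m1 m2]]
  by (simp_all add: sum_metric_def)

lemma totally_bounded_sum_metric:
  assumes "totally_bounded_metric m1" "totally_bounded_metric m2"
  shows "totally_bounded_metric (sum_metric m1 m2)"
  unfolding totally_bounded_metric_def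
proof (intro allI impI)
  fix u :: real assume "u > 0"
  then obtain C1 C2 where C1: "C1 \<subseteq> mspace m1" "finite C1" "mspace m1 \<subseteq> (\<Union>c\<in>C1. mball_of m1 c (u/2))"
    and C2: "C2 \<subseteq> mspace m2" "finite C2" "mspace m2 \<subseteq> (\<Union>c\<in>C2. mball_of m2 c (u/2))"
    using assms unfolding totally_bounded_metric_def by (meson half_gt_zero)
  have "mspace (sum_metric m1 m2) \<subseteq> (\<Union>c\<in>C1 \<times> C2. mball_of (sum_metric m1 m2) c u)"
  proof
    fix p assume "p \<in> mspace (sum_metric m1 m2)"
    then obtain x a where p: "p = (x, a)" "x \<in> mspace m1" "a \<in> mspace m2"
      by (auto simp: mspace_sum_metric)
    obtain c where c: "c \<in> C1" "x \<in> mball_of m1 c (u/2)" using C1(3) p by blast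
    obtain d where d: "d \<in> C2" "a \<in> mball_of m2 d (u/2)" using C2(3) p by blast
    have "p \<in> mball_of (sum_metric m1 m2) (c, d) u"
      using c d by (simp add: p mspace_sum_metric mdist_sum_metric)
    then show "p \<in> (\<Union>c\<in>C1 \<times> C2. mball_of (sum_metric m1 m2) c u)" using c d by blast
  qed
  then show "\<exists>C\<subseteq>mspace (sum_metric m1 m2). finite C \<and>
      mspace (sum_metric m1 m2) \<subseteq> (\<Union>c\<in>C. mball_of (sum_metric m1 m2) c u)"
    using C1 C2 by (intro exI[of _ "C1 \<times> C2"]) (auto simp: mspace_sum_metric)
qed

lemma borel_measurable_euclid_dist:
  "(\<lambda>x. euclid_dist (state_dim D) c x) \<in> borel_measurable (state_leb D)"
  unfolding euclid_dist_def L2_set_def state_leb_def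
  by (intro measurable_restrict_space1) measurable

text \<open>Suprema are 1-Lipschitz in the uniform distance. Boundedness of \<open>f\<close> follows
  from that of \<open>g\<close>, so in the applications only the family that is easy to bound has to
  be treated.\<close>

lemma abs_cSUP_diff_le:
  fixes f g :: "'a \<Rightarrow> real"
  assumes "A \<noteq> {}" "bdd_above (g ` A)" "\<And>a. a \<in> A \<Longrightarrow> \<bar>f a - g a\<bar> \<le> e"
  shows "\<bar>(SUP a\<in>A. f a) - (SUP a\<in>A. g a)\<bar> \<le> e"
proof -
  have fg: "f a \<le> (SUP a\<in>A. g a) + e" if "a \<in> A" for a
    using cSUP_upper[OF that assms(2)] assms(3)[OF that] by linarith
  then have "bdd_above (f ` A)" by (intro bdd_aboveI2)
  then have "g a \<le> (SUP a\<in>A. f a) + e" if "a \<in> A" for a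
    using cSUP_upper[OF that, of f] assms(3)[OF that] by linarith
  then have "(SUP a\<in>A. g a) \<le> (SUP a\<in>A. f a) + e" using assms(1) by (intro cSUP_least)
  moreover have "(SUP a\<in>A. f a) \<le> (SUP a\<in>A. g a) + e" using assms(1) fg by (intro cSUP_least)
  ultimately show ?thesis by linarith
qed

section \<open>The setting, its kernels and its densities\<close>

locale mesh_setting =
  fixes D :: mdp and \<delta> \<Lambda> L G :: real and \<L> :: "point \<Rightarrow> real" and x0 :: point and b :: "nat \<Rightarrow> point"
  assumes valid: "valid_mdp D"
    and compact_states: "compact_space (mtopology_of (state_metric D))"
    and compact_actions: "compact_space (mtopology_of (action_metric D))"
    and pos: "\<delta> > 0" "\<Lambda> > 0" "L > 0" "G > 0"
    and \<L>_meas[measurable]: "\<L> \<in> borel_measurable (state_leb D)"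
    and \<L>_nonneg: "y \<in> states D \<Longrightarrow> 0 \<le> \<L> y"
    and \<L>_esssup: "esssup (state_leb D) (\<lambda>y. ennreal (\<L> y)) \<le> ennreal L"
    and dens_bounds: "\<lbrakk>h \<in> {1..horizon D}; x \<in> states D; a \<in> actions D; y \<in> states D\<rbrakk> \<Longrightarrow>
      \<delta> \<le> dens D h x a y \<and> dens D h x a y \<le> \<Lambda>"
    and dens_lipschitz: "\<lbrakk>h \<in> {1..horizon D}; x \<in> states D; x' \<in> states D; a \<in> actions D;
      a' \<in> actions D; y \<in> states D\<rbrakk> \<Longrightarrow> \<bar>dens D h x a y - dens D h x' a' y\<bar>
        \<le> \<L> y * (euclid_dist (state_dim D) x x' + mdist (action_metric D) a a')"
    and rewards_le: "\<lbrakk>h < horizon D; s \<in> states D; a \<in> actions D\<rbrakk> \<Longrightarrow>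
      \<bar>reward D h s a\<bar> \<le> G \<and> \<bar>final_reward D s\<bar> \<le> G"
    and x0: "x0 \<in> states D"
    and b: "h < horizon D \<Longrightarrow> b h \<in> actions D"
    and regular: "regular_data D b x0"
begin

abbreviation "S \<equiv> states D"
abbreviation "H \<equiv> horizon D"
abbreviation "leb \<equiv> state_leb D"

lemma states_ext: "S \<subseteq> extensional {..<state_dim D}" and H_pos: "H \<ge> 1"
  using valid by (auto simp: valid_mdp_def)

lemma space_leb[simp]: "space leb = S"
  using space_state_leb[OF states_ext] .

lemma sets_S[simp, measurable]: "S \<in> sets leb"
  using sets.top[of leb] by simp

lemma actions_nonempty: "actions D \<noteq> {}"
  using b[of 0] H_pos by auto

lemma dens_meas: "\<lbrakk>h \<in> {1..H}; x \<in> S; a \<in> actions D\<rbrakk> \<Longrightarrow> dens D h x a \<in> borel_measurable leb"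
  using valid by (auto simp: valid_mdp_def)

lemma dens_nonneg: "\<lbrakk>h \<in> {1..H}; x \<in> S; a \<in> actions D; y \<in> S\<rbrakk> \<Longrightarrow> 0 \<le> dens D h x a y"
  using dens_bounds pos by (meson less_imp_le order_trans)

lemma kernel_meas:
  assumes "h \<in> {1..H}" "a \<in> actions D"
  shows "(\<lambda>x. kernel D h x a) \<in> leb \<rightarrow>\<^sub>M prob_algebra leb"
proof -
  have kernel: "(\<lambda>(x, a). kernel D h x a) \<in> leb \<Otimes>\<^sub>M action_borel D \<rightarrow>\<^sub>M prob_algebra leb"
    using valid assms by (auto simp: valid_mdp_def)
  have pair: "(\<lambda>x. (x, a)) \<in> leb \<rightarrow>\<^sub>M leb \<Otimes>\<^sub>M action_borel D"
    using assms by (intro measurable_Pair2') (simp add: space_action_borel)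
  show ?thesis using measurable_compose[OF pair kernel] by simp
qed

lemma prob_space_kernel: "\<lbrakk>h \<in> {1..H}; x \<in> S; a \<in> actions D\<rbrakk> \<Longrightarrow> prob_space (kernel D h x a)"
  using measurable_space[OF kernel_meas[of h a], of x] by (simp add: space_prob_algebra)

lemma sets_kernel[simp, measurable_cong]: "sets (kernel D h x a) = sets leb"
  by (simp add: kernel_def)

lemma nn_integral_dens:
  assumes "h \<in> {1..H}" "x \<in> S" "a \<in> actions D"
  shows "(\<integral>\<^sup>+y. ennreal (dens D h x a y) \<partial>leb) = 1"
proof -
  interpret prob_space "kernel D h x a" using assms by (rule prob_space_kernel)
  have "(\<integral>\<^sup>+y. ennreal (dens D h x a y) \<partial>leb) = emeasure (kernel D h x a) (space leb)"
    unfolding kernel_def using dens_meas[OF assms]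
    by (subst emeasure_density) (auto intro!: nn_integral_cong)
  then show ?thesis using emeasure_space_1 by (simp add: kernel_def)
qed

text \<open>A density that is at least \<open>\<delta>\<close> and integrates to 1 leaves room for a
  volume of at most \<open>1 / \<delta>\<close>. This dimension-free bound is the only control of
  the Lebesgue measure of the state space.\<close>

lemma emeasure_leb: "emeasure leb S \<le> ennreal (1 / \<delta>)"
proof -
  have "ennreal \<delta> * emeasure leb S = (\<integral>\<^sup>+y. ennreal \<delta> \<partial>leb)" by simp
  also have "\<dots> \<le> (\<integral>\<^sup>+y. ennreal (dens D 1 x0 (b 0) y) \<partial>leb)"
    using dens_bounds x0 b[of 0] H_pos by (intro nn_integral_mono ennreal_leI) auto
  also have "\<dots> = 1" using x0 b[of 0] H_pos by (intro nn_integral_dens) auto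
  finally have "ennreal (1 / \<delta>) * (ennreal \<delta> * emeasure leb S) \<le> ennreal (1 / \<delta>) * 1"
    by (rule mult_left_mono) simp
  then show ?thesis
    using pos by (simp add: mult.assoc[symmetric] ennreal_mult'[symmetric])
qed

sublocale leb: finite_measure leb
  using emeasure_leb by (intro finite_measureI) (auto simp: top_unique)

lemma measure_leb_le: "measure leb S \<le> 1 / \<delta>"
  using emeasure_leb pos by (simp add: leb.emeasure_eq_measure)

lemma integrable_bounded:
  assumes "f \<in> borel_measurable leb" "\<And>y. y \<in> S \<Longrightarrow> \<bar>f y\<bar> \<le> (c::real)"
  shows "integrable leb f"
  using assms by (intro leb.integrable_const_bound[of _ c] AE_I2) auto

lemma integral_dens:
  assumes "h \<in> {1..H}" "x \<in> S" "a \<in> actions D"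
  shows "(\<integral>y. dens D h x a y \<partial>leb) = 1"
  using nn_integral_dens[OF assms] dens_meas[OF assms] dens_nonneg[OF assms]
  by (subst integral_eq_nn_integral) auto

lemma AE_\<L>_le: "AE y in leb. \<L> y \<le> L"
proof -
  have "AE y in leb. ennreal (\<L> y) \<le> esssup leb (\<lambda>y. ennreal (\<L> y))" by (rule esssup_AE)
  then show ?thesis
  proof eventually_elim
    case (elim y)
    then have "ennreal (\<L> y) \<le> ennreal L" using \<L>_esssup by (rule order_trans)
    then show ?case using pos by (simp add: ennreal_le_iff)
  qed
qed

lemma Metric_space_S: "Metric_space S (euclid_dist (state_dim D))"
  using states_ext by (rule Metric_space_euclid)

lemma mspace_state_metric[simp]: "mspace (state_metric D) = S"
  and mdist_state_metric[simp]: "mdist (state_metric D) = euclid_dist (state_dim D)"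
  using Metric_space.mspace_metric[OF Metric_space_S] Metric_space.mdist_metric[OF Metric_space_S]
  by (simp_all add: state_metric_def)

abbreviation "SA \<equiv> state_action_metric D"

lemma mspace_SA[simp]: "mspace SA = S \<times> actions D"
  and mdist_SA: "mdist SA (x, a) (x', a') = euclid_dist (state_dim D) x x' + mdist (action_metric D) a a'"
  by (simp_all add: state_action_metric_def mspace_sum_metric mdist_sum_metric)

lemma totally_bounded_S: "totally_bounded_metric (state_metric D)"
  and totally_bounded_SA: "totally_bounded_metric SA"
  using compact_space_imp_totally_bounded_metric[OF compact_states]
    compact_space_imp_totally_bounded_metric[OF compact_actions]
  by (auto simp: state_action_metric_def intro: totally_bounded_sum_metric)

text \<open>
  Lipschitz continuity in \<open>x\<close> and measurability in \<open>y\<close> give joint measurability: averaging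
  over a finite net with a partition of unity approximates the density.
\<close>

lemma dens_joint_meas:
  assumes h: "h \<in> {1..H}" and a: "a \<in> actions D"
  shows "(\<lambda>(x, y). dens D h x a y) \<in> borel_measurable (leb \<Otimes>\<^sub>M leb)"
proof -
  have aa: "mdist (action_metric D) a a = 0" using a by (subst mdist_zero) auto
  define r where "r j = 1 / real (Suc j)" for j
  have r: "r j > 0" for j by (simp add: r_def)
  have "\<forall>j. \<exists>C. C \<subseteq> S \<and> finite C \<and> S \<subseteq> (\<Union>c\<in>C. mball_of (state_metric D) c (r j))"
    using totally_bounded_S r unfolding totally_bounded_metric_def mspace_state_metric by blast
  then obtain C where C: "\<And>j. C j \<subseteq> S \<and> finite (C j) \<and> S \<subseteq> (\<Union>c\<in>C j. mball_of (state_metric D) c (r j))"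
    by (rule choice[THEN exE]) blast
  \<comment> \<open>Tent functions: only centres closer to \<open>x\<close> than \<open>r j\<close>
    receive weight, where the Lipschitz bound is at most \<open>\<L> y * r j\<close>. Since the net
    covers the states, some weight is positive.\<close>
  define w where "w j c x = max 0 (r j - euclid_dist (state_dim D) c x)" for j c x
  define d where "d j = (\<lambda>(x, y). (\<Sum>c\<in>C j. w j c x * dens D h c a y) / (\<Sum>c\<in>C j. w j c x))" for j
  note [measurable] = borel_measurable_euclid_dist
  have w_meas[measurable]: "w j c \<in> borel_measurable leb" for j c
    unfolding w_def by measurable
  have "d j \<in> borel_measurable (leb \<Otimes>\<^sub>M leb)" for j
  proof -
    have [measurable]: "dens D h c a \<in> borel_measurable leb" if "c \<in> C j" for c
      using that C by (intro dens_meas h a) auto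
    show ?thesis unfolding d_def by measurable
  qed
  moreover have "(\<lambda>j. d j p) \<longlonglongrightarrow> (\<lambda>(x, y). dens D h x a y) p"
    if p_in: "p \<in> space (leb \<Otimes>\<^sub>M leb)" for p
  proof -
    obtain x y where p: "p = (x, y)" "x \<in> S" "y \<in> S"
      using p_in by (auto simp: space_pair_measure)
    have "\<bar>d j p - dens D h x a y\<bar> \<le> \<L> y * r j" for j
    proof -
      define W where "W = (\<Sum>c\<in>C j. w j c x)"
      have w_nonneg: "w j c x \<ge> 0" for c by (simp add: w_def)
      have "x \<in> (\<Union>c\<in>C j. mball_of (state_metric D) c (r j))" using C p by blast
      then obtain c where c: "c \<in> C j" "euclid_dist (state_dim D) c x < r j" by auto
      have "0 < w j c x" using c by (simp add: w_def)
      also have "\<dots> \<le> W" unfolding W_def using C c w_nonneg by (intro member_le_sum) auto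
      finally have W: "W > 0" .
      have "\<bar>w j c x * dens D h c a y - w j c x * dens D h x a y\<bar> \<le> w j c x * (\<L> y * r j)"
        if "c \<in> C j" for c
      proof (cases "euclid_dist (state_dim D) c x < r j")
        case True
        have "\<bar>dens D h c a y - dens D h x a y\<bar> \<le> \<L> y * (euclid_dist (state_dim D) c x + mdist (action_metric D) a a)"
          using C that p h a by (intro dens_lipschitz) auto
        also have "\<dots> \<le> \<L> y * r j" using True \<L>_nonneg p aa
          by (intro mult_left_mono) auto
        finally have "w j c x * \<bar>dens D h c a y - dens D h x a y\<bar> \<le> w j c x * (\<L> y * r j)"
          using w_nonneg by (intro mult_left_mono)
        then show ?thesis using w_nonneg[of c]
          by (simp add: right_diff_distrib[symmetric] abs_mult)
      qed (simp add: w_def)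
      then have "\<bar>\<Sum>c\<in>C j. (w j c x * dens D h c a y - w j c x * dens D h x a y)\<bar> \<le> (\<Sum>c\<in>C j. w j c x * (\<L> y * r j))"
        by (intro order_trans[OF sum_abs] sum_mono)
      moreover have "(\<Sum>c\<in>C j. w j c x * (\<L> y * r j)) = W * (\<L> y * r j)"
        unfolding W_def by (rule sum_distrib_right[symmetric])
      moreover have "(\<Sum>c\<in>C j. (w j c x * dens D h c a y - w j c x * dens D h x a y)) =
          W * (d j p - dens D h x a y)"
        using W by (simp add: sum_subtractf d_def p W_def[symmetric] right_diff_distrib)
          (simp add: W_def sum_distrib_right)
      ultimately have "W * \<bar>d j p - dens D h x a y\<bar> \<le> W * (\<L> y * r j)" using W by (simp add: abs_mult)
      then show ?thesis using W by simp
    qed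
    moreover have "(\<lambda>j. \<L> y * r j) \<longlonglongrightarrow> 0"
      unfolding r_def using LIMSEQ_inverse_real_of_nat
      by (intro tendsto_mult_right_zero) (simp add: inverse_eq_divide)
    ultimately have "(\<lambda>j. d j p - dens D h x a y) \<longlonglongrightarrow> 0"
      by (intro Lim_null_comparison[of "\<lambda>j. d j p - dens D h x a y" "\<lambda>j. \<L> y * r j"]) auto
    then have "(\<lambda>j. d j p) \<longlonglongrightarrow> dens D h x a y" by (simp add: LIM_zero_iff)
    then show ?thesis by (simp add: p)
  qed
  ultimately show ?thesis by (rule borel_measurable_LIMSEQ_metric)
qed


section \<open>The law of one chain\<close>

abbreviation "states_upto k \<equiv> \<Pi>\<^sub>M i\<in>{..k}. leb"

lemma chain_step_meas:
  assumes "k < H"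
  shows "(\<lambda>s. kernel D (Suc k) (s k) (b k) \<bind> (\<lambda>y. return (states_upto (Suc k)) (s(Suc k := y))))
    \<in> states_upto k \<rightarrow>\<^sub>M prob_algebra (states_upto (Suc k))"
proof (rule measurable_bind_prob_space2)
  show "(\<lambda>s. kernel D (Suc k) (s k) (b k)) \<in> states_upto k \<rightarrow>\<^sub>M prob_algebra leb"
    using assms b
    by (intro measurable_compose[where f = "\<lambda>s. s k" and g = "\<lambda>x. kernel D (Suc k) x (b k)", OF _ kernel_meas]
        measurable_component_singleton) auto
  have "(\<lambda>(s, y). s(Suc k := y)) \<in> states_upto k \<Otimes>\<^sub>M leb \<rightarrow>\<^sub>M PiM (insert (Suc k) {..k}) (\<lambda>_. leb)"
    by (rule measurable_add_dim)
  then have "(\<lambda>(s, y). s(Suc k := y)) \<in> states_upto k \<Otimes>\<^sub>M leb \<rightarrow>\<^sub>M states_upto (Suc k)"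
    by (simp add: atMost_Suc)
  from measurable_compose[OF this measurable_return_prob_space]
  show "(\<lambda>(s, y). return (states_upto (Suc k)) (s(Suc k := y)))
      \<in> states_upto k \<Otimes>\<^sub>M leb \<rightarrow>\<^sub>M prob_algebra (states_upto (Suc k))"
    by (simp add: case_prod_beta')
qed

lemma chain_law_prob: "k \<le> H \<Longrightarrow> chain_law D b x0 k \<in> space (prob_algebra (states_upto k))"
proof (induction k)
  case 0
  have "(\<lambda>i\<in>{..0}. x0) \<in> space (states_upto 0)" using x0 by (simp add: space_PiM)
  then have "prob_space (chain_law D b x0 0)" unfolding chain_law.simps by (rule prob_space_return)
  then show ?case by (simp add: space_prob_algebra)
next
  case (Suc k)
  have "(\<lambda>_. chain_law D b x0 (Suc k)) \<in> count_space UNIV \<rightarrow>\<^sub>M prob_algebra (states_upto (Suc k))"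
    unfolding chain_law.simps using Suc
    by (intro measurable_bind_prob_space[OF measurable_const chain_step_meas]) auto
  from measurable_space[OF this, of undefined] show ?case by simp
qed

lemma prob_space_chain: "k \<le> H \<Longrightarrow> prob_space (chain_law D b x0 k)"
  and sets_chain: "k \<le> H \<Longrightarrow> sets (chain_law D b x0 k) = sets (states_upto k)"
  using chain_law_prob by (auto simp: space_prob_algebra)

lemma space_chain: "k \<le> H \<Longrightarrow> space (chain_law D b x0 k) = space (states_upto k)"
  using sets_chain by (rule sets_eq_imp_space_eq)

lemma space_states_uptoD: "s \<in> space (states_upto k) \<Longrightarrow> h \<le> k \<Longrightarrow> s h \<in> S"
  by (auto simp: space_PiM PiE_iff)

lemma nn_integral_chain_Suc:
  assumes k: "k < H" and f: "f \<in> borel_measurable (states_upto (Suc k))"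
  shows "(\<integral>\<^sup>+s. f s \<partial>chain_law D b x0 (Suc k)) =
    (\<integral>\<^sup>+s. \<integral>\<^sup>+y. f (s(Suc k := y)) \<partial>kernel D (Suc k) (s k) (b k) \<partial>chain_law D b x0 k)"
proof -
  have step: "(\<lambda>s. kernel D (Suc k) (s k) (b k) \<bind> (\<lambda>y. return (states_upto (Suc k)) (s(Suc k := y))))
    \<in> chain_law D b x0 k \<rightarrow>\<^sub>M subprob_algebra (states_upto (Suc k))"
    using measurable_prob_algebraD[OF chain_step_meas[OF k]] sets_chain[of k] k
    by (simp cong: measurable_cong_sets)
  have "(\<integral>\<^sup>+s. f s \<partial>chain_law D b x0 (Suc k)) = (\<integral>\<^sup>+s. \<integral>\<^sup>+z. f z \<partial>(kernel D (Suc k) (s k) (b k) \<bind>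
      (\<lambda>y. return (states_upto (Suc k)) (s(Suc k := y)))) \<partial>chain_law D b x0 k)"
    unfolding chain_law.simps by (rule nn_integral_bind[OF f step])
  also have "\<dots> = (\<integral>\<^sup>+s. \<integral>\<^sup>+y. f (s(Suc k := y)) \<partial>kernel D (Suc k) (s k) (b k) \<partial>chain_law D b x0 k)"
  proof (rule nn_integral_cong)
    fix s assume "s \<in> space (chain_law D b x0 k)"
    then have s: "s \<in> space (states_upto k)" using space_chain k by auto
    have upd: "(\<lambda>y. s(Suc k := y)) \<in> leb \<rightarrow>\<^sub>M states_upto (Suc k)"
      using measurable_component_update[of s "{..k}" "\<lambda>_. leb" "Suc k"] s by (simp add: atMost_Suc)
    then have upd': "(\<lambda>y. s(Suc k := y)) \<in> kernel D (Suc k) (s k) (b k) \<rightarrow>\<^sub>M states_upto (Suc k)"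
      by (simp cong: measurable_cong_sets)
    have "(\<lambda>y. return (states_upto (Suc k)) (s(Suc k := y)))
        \<in> kernel D (Suc k) (s k) (b k) \<rightarrow>\<^sub>M subprob_algebra (states_upto (Suc k))"
      by (rule measurable_compose[OF upd' return_measurable])
    then have "(\<integral>\<^sup>+z. f z \<partial>(kernel D (Suc k) (s k) (b k) \<bind>
        (\<lambda>y. return (states_upto (Suc k)) (s(Suc k := y))))) =
      (\<integral>\<^sup>+y. \<integral>\<^sup>+z. f z \<partial>return (states_upto (Suc k)) (s(Suc k := y)) \<partial>kernel D (Suc k) (s k) (b k))"
      by (rule nn_integral_bind[OF f])
    also have "\<dots> = (\<integral>\<^sup>+y. f (s(Suc k := y)) \<partial>kernel D (Suc k) (s k) (b k))"
      using measurable_space[OF upd'] by (intro nn_integral_cong nn_integral_return f) auto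
    finally show "(\<integral>\<^sup>+z. f z \<partial>(kernel D (Suc k) (s k) (b k) \<bind>
        (\<lambda>y. return (states_upto (Suc k)) (s(Suc k := y))))) =
      (\<integral>\<^sup>+y. f (s(Suc k := y)) \<partial>kernel D (Suc k) (s k) (b k))" .
  qed
  finally show ?thesis .
qed

text \<open>The steps after time \<open>h + 1\<close> do not touch the two coordinates and integrate
  out because each kernel has mass 1.\<close>

lemma nn_integral_chain_pair:
  assumes "h < k" "k \<le> H" and f[measurable]: "f \<in> borel_measurable (leb \<Otimes>\<^sub>M leb)"
  shows "(\<integral>\<^sup>+s. f (s h, s (Suc h)) \<partial>chain_law D b x0 k) =
    (\<integral>\<^sup>+s. \<integral>\<^sup>+y. f (s h, y) \<partial>kernel D (Suc h) (s h) (b h) \<partial>chain_law D b x0 h)"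
  using assms(1,2)
proof (induction k)
  case (Suc k)
  have meas: "(\<lambda>s. f (s h, s (Suc h))) \<in> borel_measurable (states_upto (Suc k))"
    using Suc.prems by (intro measurable_compose[OF _ f] measurable_Pair measurable_component_singleton) auto
  show ?case
  proof (cases "h = k")
    case True
    then show ?thesis using nn_integral_chain_Suc[OF _ meas] Suc.prems by simp
  next
    case False
    have "(\<integral>\<^sup>+s. f (s h, s (Suc h)) \<partial>chain_law D b x0 (Suc k)) =
        (\<integral>\<^sup>+s. \<integral>\<^sup>+y. f (s h, s (Suc h)) \<partial>kernel D (Suc k) (s k) (b k) \<partial>chain_law D b x0 k)"
      using nn_integral_chain_Suc[OF _ meas] Suc.prems False by simp
    also have "\<dots> = (\<integral>\<^sup>+s. f (s h, s (Suc h)) \<partial>chain_law D b x0 k)"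
    proof (rule nn_integral_cong)
      fix s assume "s \<in> space (chain_law D b x0 k)"
      then have "s k \<in> S" using space_chain[of k] Suc.prems space_states_uptoD by auto
      then interpret prob_space "kernel D (Suc k) (s k) (b k)"
        using Suc.prems b by (intro prob_space_kernel) auto
      show "(\<integral>\<^sup>+y. f (s h, s (Suc h)) \<partial>kernel D (Suc k) (s k) (b k)) = f (s h, s (Suc h))"
        by (simp add: emeasure_space_1)
    qed
    finally show ?thesis using Suc False by simp
  qed
qed simp

section \<open>The independent chains\<close>

lemma component_meas:
  assumes "n \<in> {1..N}" "h \<le> H"
  shows "(\<lambda>\<omega>. \<omega> n h) \<in> sample_law D b x0 N \<rightarrow>\<^sub>M leb"
proof -
  have "(\<lambda>\<omega>. \<omega> n) \<in> sample_law D b x0 N \<rightarrow>\<^sub>M chain_law D b x0 H"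
    unfolding sample_law_def using assms by (intro measurable_component_singleton)
  moreover have "(\<lambda>s. s h) \<in> chain_law D b x0 H \<rightarrow>\<^sub>M leb"
    using assms sets_chain[of H] by (simp add: measurable_component_singleton cong: measurable_cong_sets)
  ultimately show ?thesis by (rule measurable_compose)
qed

lemma prob_space_sample: "prob_space (sample_law D b x0 N)"
  unfolding sample_law_def by (intro prob_space_PiM prob_space_chain) simp

lemma space_sampleD: "\<omega> \<in> space (sample_law D b x0 N) \<Longrightarrow> n \<in> {1..N} \<Longrightarrow> h \<le> H \<Longrightarrow> \<omega> n h \<in> S"
  using measurable_space[OF component_meas] by simp

text \<open>Each chain is projected to its states at times \<open>h\<close> and
  \<open>h + 1\<close>. The chains being independent, the pairs are independent with common law
  \<open>\<nu>\<close>, which disintegrates through the transition kernel by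
  \<open>nn_integral_chain_pair\<close>.\<close>

lemma nn_integral_sample_le:
  assumes h: "h < H" and f[measurable]: "f \<in> borel_measurable (\<Pi>\<^sub>M n\<in>{1..N}. leb \<Otimes>\<^sub>M leb)"
    and le: "\<And>s. s \<in> space (\<Pi>\<^sub>M n\<in>{1..N}. leb) \<Longrightarrow>
      (\<integral>\<^sup>+y. f (\<lambda>n\<in>{1..N}. (s n, y n)) \<partial>PiM {1..N} (\<lambda>n. kernel D (Suc h) (s n) (b h))) \<le> c"
  shows "(\<integral>\<^sup>+\<omega>. f (\<lambda>n\<in>{1..N}. (\<omega> n h, \<omega> n (Suc h))) \<partial>sample_law D b x0 N) \<le> c"
proof -
  let ?C = "chain_law D b x0"
  define \<mu> where "\<mu> = distr (?C h) leb (\<lambda>s. s h)"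
  define \<nu> where "\<nu> = distr (?C H) (leb \<Otimes>\<^sub>M leb) (\<lambda>s. (s h, s (Suc h)))"
  have mh: "(\<lambda>s. s h) \<in> ?C h \<rightarrow>\<^sub>M leb"
    using h sets_chain[of h] by (simp add: measurable_component_singleton cong: measurable_cong_sets)
  have mp: "(\<lambda>s. (s h, s (Suc h))) \<in> ?C H \<rightarrow>\<^sub>M leb \<Otimes>\<^sub>M leb"
    using h sets_chain[of H]
    by (intro measurable_Pair) (simp_all add: measurable_component_singleton cong: measurable_cong_sets)
  have K: "(\<lambda>x. kernel D (Suc h) x (b h)) \<in> leb \<rightarrow>\<^sub>M prob_algebra leb"
    using h b by (intro kernel_meas) auto
  have \<mu>: "\<mu> \<in> space (prob_algebra leb)"
    using prob_space.prob_space_distr[OF prob_space_chain mh] h by (simp add: \<mu>_def space_prob_algebra)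
  have \<nu>: "\<nu> \<in> space (prob_algebra (leb \<Otimes>\<^sub>M leb))"
    using prob_space.prob_space_distr[OF prob_space_chain mp] h by (simp add: \<nu>_def space_prob_algebra)
  have dis: "emeasure \<nu> B = (\<integral>\<^sup>+x. emeasure (kernel D (Suc h) x (b h)) (Pair x -` B) \<partial>\<mu>)"
    if B[measurable]: "B \<in> sets (leb \<Otimes>\<^sub>M leb)" for B
  proof -
    have sec: "(\<integral>\<^sup>+y. indicator B (x, y) \<partial>kernel D (Suc h) x (b h)) =
        emeasure (kernel D (Suc h) x (b h)) (Pair x -` B)" for x
    proof -
      have "(\<integral>\<^sup>+y. indicator B (x, y) \<partial>kernel D (Suc h) x (b h)) =
          (\<integral>\<^sup>+y. indicator (Pair x -` B) y \<partial>kernel D (Suc h) x (b h))"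
        by (intro nn_integral_cong) (auto simp: indicator_def)
      also have "\<dots> = emeasure (kernel D (Suc h) x (b h)) (Pair x -` B)"
        using sets_Pair1[OF B] by (intro nn_integral_indicator) simp
      finally show ?thesis .
    qed
    have "(\<lambda>(x, y). indicator B (x, y) :: ennreal) \<in> borel_measurable (leb \<Otimes>\<^sub>M leb)"
      by (simp add: case_prod_beta')
    then have meas: "(\<lambda>x. \<integral>\<^sup>+y. indicator B (x, y) \<partial>kernel D (Suc h) x (b h)) \<in> borel_measurable leb"
      by (rule nn_integral_measurable_subprob_algebra2[OF _ measurable_prob_algebraD[OF K]])
    have "emeasure \<nu> B = (\<integral>\<^sup>+p. indicator B p \<partial>\<nu>)"
      using B by (simp add: \<nu>_def)
    also have "\<dots> = (\<integral>\<^sup>+s. indicator B (s h, s (Suc h)) \<partial>?C H)"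
      unfolding \<nu>_def by (rule nn_integral_distr[OF mp]) simp
    also have "\<dots> = (\<integral>\<^sup>+s. \<integral>\<^sup>+y. indicator B (s h, y) \<partial>kernel D (Suc h) (s h) (b h) \<partial>?C h)"
      using h by (intro nn_integral_chain_pair) auto
    also have "\<dots> = (\<integral>\<^sup>+x. \<integral>\<^sup>+y. indicator B (x, y) \<partial>kernel D (Suc h) x (b h) \<partial>\<mu>)"
      unfolding \<mu>_def by (subst nn_integral_distr[OF mh]) (simp_all add: meas)
    finally show ?thesis by (simp add: sec)
  qed
  have eq: "sets (\<Pi>\<^sub>M n\<in>{1..N}. \<nu>) = sets (\<Pi>\<^sub>M n\<in>{1..N}. leb \<Otimes>\<^sub>M leb)"
    by (intro sets_PiM_cong) (auto simp: \<nu>_def)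
  then have f\<nu>: "f \<in> borel_measurable (\<Pi>\<^sub>M n\<in>{1..N}. \<nu>)" using f by (simp cong: measurable_cong_sets)
  have "(\<lambda>\<omega>. \<lambda>n\<in>{1..N}. (\<omega> n h, \<omega> n (Suc h))) \<in> sample_law D b x0 N \<rightarrow>\<^sub>M (\<Pi>\<^sub>M n\<in>{1..N}. leb \<Otimes>\<^sub>M leb)"
    using h by (intro measurable_restrict measurable_Pair component_meas) auto
  then have T: "compose {1..N} (\<lambda>s. (s h, s (Suc h))) \<in> sample_law D b x0 N \<rightarrow>\<^sub>M (\<Pi>\<^sub>M n\<in>{1..N}. \<nu>)"
    using eq by (simp add: compose_def[abs_def] cong: measurable_cong_sets)
  have "(\<integral>\<^sup>+\<omega>. f (\<lambda>n\<in>{1..N}. (\<omega> n h, \<omega> n (Suc h))) \<partial>sample_law D b x0 N) =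
      (\<integral>\<^sup>+z. f z \<partial>distr (sample_law D b x0 N) (\<Pi>\<^sub>M n\<in>{1..N}. \<nu>) (compose {1..N} (\<lambda>s. (s h, s (Suc h)))))"
    using f\<nu> by (subst nn_integral_distr[OF T]) (simp_all add: compose_def)
  also have "distr (sample_law D b x0 N) (\<Pi>\<^sub>M n\<in>{1..N}. \<nu>) (compose {1..N} (\<lambda>s. (s h, s (Suc h)))) =
      (\<Pi>\<^sub>M n\<in>{1..N}. distr (?C H) \<nu> (\<lambda>s. (s h, s (Suc h))))"
    unfolding sample_law_def using \<nu> mp
    by (intro distr_PiM_finite_prob_space' prob_space_chain)
       (auto simp: space_prob_algebra \<nu>_def cong: measurable_cong_sets)
  also have "distr (?C H) \<nu> (\<lambda>s. (s h, s (Suc h))) = \<nu>"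
    by (subst (2) \<nu>_def) (intro distr_cong, auto simp: \<nu>_def)
  also have "(\<integral>\<^sup>+z. f z \<partial>(\<Pi>\<^sub>M n\<in>{1..N}. \<nu>)) \<le> c"
    by (rule nn_integral_PiM_disintegrate_le[OF _ K \<mu> \<nu> dis f le]) simp_all
  finally show ?thesis .
qed

text \<open>The essential supremum bounds \<open>\<L>\<close> only off a null set, and transition
  laws with a density do not charge it. The times start at 1: the initial state is the fixed point
  \<open>x0\<close>, which may lie in the null set.\<close>

lemma AE_sample_\<L>_le:
  "AE \<omega> in sample_law D b x0 N. \<forall>n\<in>{1..N}. \<forall>h<H. \<L> (\<omega> n (Suc h)) \<le> L"
proof -
  have "AE s in chain_law D b x0 H. \<L> (s (Suc h)) \<le> L" if h: "h < H" for h
  proof -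
    \<comment> \<open>The indicator concerns the second coordinate only; it is posed on pairs to fit
      \<open>nn_integral_chain_pair\<close>.\<close>
    let ?f = "\<lambda>(x, y). indicator {y \<in> S. L < \<L> y} y :: ennreal"
    have B[measurable]: "{y \<in> S. L < \<L> y} \<in> sets leb"
      using measurable_sets[OF \<L>_meas, of "{L<..}"] by (simp add: vimage_def Int_def conj_commute)
    have f: "?f \<in> borel_measurable (leb \<Otimes>\<^sub>M leb)" by measurable
    have "(\<integral>\<^sup>+s. ?f (s h, s (Suc h)) \<partial>chain_law D b x0 H) =
        (\<integral>\<^sup>+s. \<integral>\<^sup>+y. ?f (s h, y) \<partial>kernel D (Suc h) (s h) (b h) \<partial>chain_law D b x0 h)"
      by (rule nn_integral_chain_pair[OF h order.refl f])
    also have "\<dots> = (\<integral>\<^sup>+s. 0 \<partial>chain_law D b x0 h)"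
    proof (rule nn_integral_cong)
      fix s assume "s \<in> space (chain_law D b x0 h)"
      then have "s h \<in> S" using space_chain[of h] h space_states_uptoD by auto
      then have "dens D (Suc h) (s h) (b h) \<in> borel_measurable leb"
        using h b by (intro dens_meas) auto
      then have "AE y in kernel D (Suc h) (s h) (b h). \<L> y \<le> L"
        unfolding kernel_def using AE_\<L>_le by (subst AE_density) auto
      then have "AE y in kernel D (Suc h) (s h) (b h). ?f (s h, y) = 0"
        by eventually_elim auto
      then show "(\<integral>\<^sup>+y. ?f (s h, y) \<partial>kernel D (Suc h) (s h) (b h)) = 0"
        by (subst nn_integral_0_iff_AE) auto
    qed
    finally have "(\<integral>\<^sup>+s. ?f (s h, s (Suc h)) \<partial>chain_law D b x0 H) = 0" by simp
    moreover have "(\<lambda>s. ?f (s h, s (Suc h))) \<in> borel_measurable (chain_law D b x0 H)"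
    proof -
      have "(\<lambda>s. s (Suc h)) \<in> states_upto H \<rightarrow>\<^sub>M leb"
        using h by (intro measurable_component_singleton) simp
      then have "(\<lambda>s. s (Suc h)) \<in> chain_law D b x0 H \<rightarrow>\<^sub>M leb"
        using sets_chain[of H] by (simp cong: measurable_cong_sets)
      then show ?thesis by simp
    qed
    ultimately have "AE s in chain_law D b x0 H. ?f (s h, s (Suc h)) = 0"
      by (subst (asm) nn_integral_0_iff_AE) auto
    then show ?thesis using AE_space
    proof eventually_elim
      case (elim s)
      then have "s (Suc h) \<in> S" using space_chain[of H] h space_states_uptoD[of s H "Suc h"] by simp
      then show ?case using elim(1) by (auto simp: indicator_def split: if_splits)
    qed
  qed
  then have "AE \<omega> in sample_law D b x0 N. \<L> (\<omega> n (Suc h)) \<le> L" if "n \<in> {1..N}" "h \<in> {..<H}" for n h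
    unfolding sample_law_def using that prob_space_chain[of H]
    by (intro AE_PiM_component[where P = "\<lambda>s. \<L> (s (Suc h)) \<le> L"]) auto
  then have "AE \<omega> in sample_law D b x0 N. \<forall>n\<in>{1..N}. \<forall>h\<in>{..<H}. \<L> (\<omega> n (Suc h)) \<le> L"
    by (intro AE_finite_allI) auto
  then show ?thesis by eventually_elim auto
qed


section \<open>The one-step error of the mesh\<close>

text \<open>
  In contrast to \<^const>\<open>mesh_ratio\<close>, the sum over \<open>k\<close> contains the chain that is evaluated; this is
  what makes \<open>mesh_error\<close> exactly centred given the states at time \<open>h\<close>.
\<close>

definition mixture_density :: "nat \<Rightarrow> nat \<Rightarrow> (nat \<Rightarrow> nat \<Rightarrow> point) \<Rightarrow> point \<Rightarrow> real" where
  "mixture_density N h \<omega> y = (\<Sum>k\<in>{1..N}. dens D (Suc h) (\<omega> k h) (b h) y)"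

definition mesh_error :: "nat \<Rightarrow> nat \<Rightarrow> (point \<Rightarrow> real) \<Rightarrow> (nat \<Rightarrow> nat \<Rightarrow> point) \<Rightarrow> real" where
  "mesh_error N h g \<omega> =
     (\<Sum>n\<in>{1..N}. g (\<omega> n (Suc h)) / mixture_density N h \<omega> (\<omega> n (Suc h))) - (\<integral>y. g y \<partial>leb)"

lemma mixture_density_ge:
  assumes "h < H" "\<And>n. n \<in> {1..N} \<Longrightarrow> \<omega> n h \<in> S" "y \<in> S"
  shows "real N * \<delta> \<le> mixture_density N h \<omega> y"
proof -
  have "real (card {1..N}) * \<delta> \<le> mixture_density N h \<omega> y"
    unfolding mixture_density_def using assms b dens_bounds by (intro sum_bounded_below) auto
  then show ?thesis by simp
qed

text \<open>The mixture evaluates the density at the states of two chains at once, so measurability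
  in the target state alone would not suffice and \<open>dens_joint_meas\<close> is used.\<close>

lemma mesh_error_meas:
  assumes h: "h < H" and [measurable]: "g \<in> borel_measurable leb"
  shows "mesh_error N h g \<in> borel_measurable (sample_law D b x0 N)"
proof -
  have [measurable]: "(\<lambda>\<omega>. \<omega> n (Suc h)) \<in> sample_law D b x0 N \<rightarrow>\<^sub>M leb"
    "(\<lambda>\<omega>. \<omega> n h) \<in> sample_law D b x0 N \<rightarrow>\<^sub>M leb" if "n \<in> {1..N}" for n
    using that h by (auto intro: component_meas)
  have [measurable]: "(\<lambda>(x, y). dens D (Suc h) x (b h) y) \<in> borel_measurable (leb \<Otimes>\<^sub>M leb)"
    using h b by (intro dens_joint_meas) auto
  have [measurable]: "(\<lambda>\<omega>. dens D (Suc h) (\<omega> k h) (b h) (\<omega> n (Suc h))) \<in> borel_measurable (sample_law D b x0 N)"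
    if "k \<in> {1..N}" "n \<in> {1..N}" for k n
  proof -
    have "(\<lambda>\<omega>. (\<omega> k h, \<omega> n (Suc h))) \<in> sample_law D b x0 N \<rightarrow>\<^sub>M leb \<Otimes>\<^sub>M leb"
      using that by measurable
    from measurable_compose[OF this dens_joint_meas[of "Suc h" "b h"]] show ?thesis
      using h b by simp
  qed
  show ?thesis unfolding mesh_error_def mixture_density_def by measurable
qed

text \<open>The sum and the integral are each at most \<open>c / \<delta>\<close>, the first because
  the mixture is at least \<open>N * \<delta>\<close>, the second because the state space has volume
  at most \<open>1 / \<delta>\<close>. The bound on \<open>g\<close> is asked only at the sampled
  points and almost everywhere, since the Lipschitz estimates to which this is applied hold only
  there.\<close>

lemma mesh_error_le:
  assumes h: "h < H" and "N \<ge> 1" and \<omega>: "\<And>n j. n \<in> {1..N} \<Longrightarrow> j \<le> H \<Longrightarrow> \<omega> n j \<in> S"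
    and g: "g \<in> borel_measurable leb" and c: "\<And>n. n \<in> {1..N} \<Longrightarrow> \<bar>g (\<omega> n (Suc h))\<bar> \<le> c"
    and ae: "AE y in leb. \<bar>g y\<bar> \<le> c" and "c \<ge> 0"
  shows "\<bar>mesh_error N h g \<omega>\<bar> \<le> 2 * c / \<delta>"
proof -
  have "\<bar>\<Sum>n\<in>{1..N}. g (\<omega> n (Suc h)) / mixture_density N h \<omega> (\<omega> n (Suc h))\<bar> \<le>
      (\<Sum>n\<in>{1..N}. c / (real N * \<delta>))"
  proof (intro order_trans[OF sum_abs] sum_mono)
    fix n assume n: "n \<in> {1..N}"
    have ge: "real N * \<delta> \<le> mixture_density N h \<omega> (\<omega> n (Suc h))"
      using h \<omega> n by (intro mixture_density_ge) auto
    have p: "0 < real N * \<delta>" using \<open>N \<ge> 1\<close> pos by simp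
    have "\<bar>g (\<omega> n (Suc h)) / mixture_density N h \<omega> (\<omega> n (Suc h))\<bar> =
        \<bar>g (\<omega> n (Suc h))\<bar> / mixture_density N h \<omega> (\<omega> n (Suc h))"
      using ge p by simp
    also have "\<dots> \<le> c / (real N * \<delta>)" using ge p c[OF n] \<open>c \<ge> 0\<close> by (intro frac_le) auto
    finally show "\<bar>g (\<omega> n (Suc h)) / mixture_density N h \<omega> (\<omega> n (Suc h))\<bar> \<le> c / (real N * \<delta>)" .
  qed
  also have "\<dots> = c / \<delta>" using \<open>N \<ge> 1\<close> pos by simp
  finally have 1: "\<bar>\<Sum>n\<in>{1..N}. g (\<omega> n (Suc h)) / mixture_density N h \<omega> (\<omega> n (Suc h))\<bar> \<le> c / \<delta>" .
  have int: "integrable leb g" using ae g by (intro leb.integrable_const_bound[of _ c]) auto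
  have "\<bar>\<integral>y. g y \<partial>leb\<bar> \<le> (\<integral>y. \<bar>g y\<bar> \<partial>leb)" by (rule integral_abs_bound)
  also have "\<dots> \<le> (\<integral>y. c \<partial>leb)" using int ae by (intro integral_mono_AE) auto
  also have "\<dots> \<le> c / \<delta>" using mult_left_mono[OF measure_leb_le \<open>c \<ge> 0\<close>] by (simp add: mult.commute)
  finally show ?thesis using 1 unfolding mesh_error_def by linarith
qed

lemma mesh_error_integrable:
  assumes "h < H" "N \<ge> 1" "g \<in> borel_measurable leb" "\<And>y. y \<in> S \<Longrightarrow> \<bar>g y\<bar> \<le> c"
  shows "integrable (sample_law D b x0 N) (mesh_error N h g)"
proof -
  interpret prob_space "sample_law D b x0 N" by (rule prob_space_sample)
  have "c \<ge> 0" using assms(4)[OF x0] by simp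
  have "\<bar>mesh_error N h g \<omega>\<bar> \<le> 2 * c / \<delta>" if \<omega>: "\<omega> \<in> space (sample_law D b x0 N)" for \<omega>
  proof (rule mesh_error_le[OF assms(1,2) space_sampleD[OF \<omega>] assms(3)])
    show "\<bar>g (\<omega> n (Suc h))\<bar> \<le> c" if "n \<in> {1..N}" for n
      using assms(1,4) space_sampleD[OF \<omega> that, of "Suc h"] by simp
  qed (use assms \<open>c \<ge> 0\<close> in auto)
  then show ?thesis
    using assms by (intro integrable_const_bound[of _ "2 * c / \<delta>"] mesh_error_meas AE_I2) auto
qed

text \<open>Given the states at time \<open>h\<close> this is \<open>mixture_estimator_mgf\<close>.
  Its bound involves only \<open>c\<close>, \<open>\<delta>\<close> and \<open>N\<close>, not those
  states, so \<open>nn_integral_sample_le\<close> carries it over to the full sample.\<close>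

lemma mesh_error_mgf:
  assumes h: "h < H" and N: "N \<ge> 1" and g[measurable]: "g \<in> borel_measurable leb"
    and c: "AE y in leb. \<bar>g y\<bar> \<le> c" "c \<ge> 0" and l: "l > 0"
  shows "(\<integral>\<^sup>+\<omega>. ennreal (exp (l * mesh_error N h g \<omega>)) \<partial>sample_law D b x0 N)
    \<le> ennreal (exp (l\<^sup>2 * (c / (\<delta> * sqrt (real N)))\<^sup>2 / 2))"
proof -
  define f where "f z = ennreal (exp (l * ((\<Sum>n\<in>{1..N}. g (snd (z n)) /
      (\<Sum>k\<in>{1..N}. dens D (Suc h) (fst (z k)) (b h) (snd (z n)))) - (\<integral>y. g y \<partial>leb))))"
    for z :: "nat \<Rightarrow> point \<times> point"
  have f_eq: "f (\<lambda>n\<in>{1..N}. (s n, y n)) = ennreal (exp (l * ((\<Sum>n\<in>{1..N}. g (y n) /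
      (\<Sum>k\<in>{1..N}. dens D (Suc h) (s k) (b h) (y n))) - (\<integral>y. g y \<partial>leb))))" for s y
    unfolding f_def
    by (intro arg_cong[where f = "\<lambda>u. ennreal (exp (l * (u - (\<integral>y. g y \<partial>leb))))"] sum.cong refl
        arg_cong2[where f = "(/)"]) simp_all
  have hb: "Suc h \<in> {1..H}" "b h \<in> actions D" using h b by auto
  have [measurable]: "(\<lambda>z. dens D (Suc h) (fst (z k)) (b h) (snd (z n)))
      \<in> borel_measurable (\<Pi>\<^sub>M n\<in>{1..N}. leb \<Otimes>\<^sub>M leb)" if "k \<in> {1..N}" "n \<in> {1..N}" for k n
  proof -
    have "(\<lambda>z. (fst (z k), snd (z n))) \<in> (\<Pi>\<^sub>M n\<in>{1..N}. leb \<Otimes>\<^sub>M leb) \<rightarrow>\<^sub>M leb \<Otimes>\<^sub>M leb"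
      using that by measurable
    from measurable_compose[OF this dens_joint_meas[OF hb]] show ?thesis by simp
  qed
  have f: "f \<in> borel_measurable (\<Pi>\<^sub>M n\<in>{1..N}. leb \<Otimes>\<^sub>M leb)" unfolding f_def by measurable
  have "(\<integral>\<^sup>+y. f (\<lambda>n\<in>{1..N}. (s n, y n)) \<partial>PiM {1..N} (\<lambda>n. kernel D (Suc h) (s n) (b h)))
      \<le> ennreal (exp (l\<^sup>2 * (c\<^sup>2 / (\<delta>\<^sup>2 * real (card {1..N}))) / 2))"
    if s: "s \<in> space (\<Pi>\<^sub>M n\<in>{1..N}. leb)" for s
  proof -
    have sn: "s n \<in> S" if "n \<in> {1..N}" for n using s that by (auto simp: space_PiM PiE_iff)
    have "(\<integral>\<^sup>+y. ennreal (exp (l * ((\<Sum>n\<in>{1..N}. g (y n) / (\<Sum>k\<in>{1..N}. dens D (Suc h) (s k) (b h) (y n)))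
        - (\<integral>y. g y \<partial>leb)))) \<partial>PiM {1..N} (\<lambda>n. density leb (\<lambda>y. ennreal (dens D (Suc h) (s n) (b h) y))))
      \<le> ennreal (exp (l\<^sup>2 * (c\<^sup>2 / (\<delta>\<^sup>2 * real (card {1..N}))) / 2))"
    proof (rule mixture_estimator_mgf)
      show "prob_space (density leb (\<lambda>y. ennreal (dens D (Suc h) (s n) (b h) y)))" if "n \<in> {1..N}" for n
        using prob_space_kernel[OF hb(1) sn[OF that] hb(2)] by (simp add: kernel_def)
    qed (use N pos c l hb sn dens_meas dens_bounds in auto)
    then show ?thesis by (simp only: f_eq kernel_def)
  qed
  then have "(\<integral>\<^sup>+\<omega>. f (\<lambda>n\<in>{1..N}. (\<omega> n h, \<omega> n (Suc h))) \<partial>sample_law D b x0 N)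
      \<le> ennreal (exp (l\<^sup>2 * (c\<^sup>2 / (\<delta>\<^sup>2 * real (card {1..N}))) / 2))"
    by (rule nn_integral_sample_le[OF h f])
  moreover have "f (\<lambda>n\<in>{1..N}. (\<omega> n h, \<omega> n (Suc h))) = ennreal (exp (l * mesh_error N h g \<omega>))" for \<omega>
    by (simp only: f_eq mesh_error_def mixture_density_def)
  ultimately show ?thesis by (simp add: power_divide power_mult_distrib)
qed

lemma mesh_error_diff:
  assumes "integrable leb f" "integrable leb g"
  shows "mesh_error N h f \<omega> - mesh_error N h g \<omega> = mesh_error N h (\<lambda>y. f y - g y) \<omega>"
  using assms by (simp add: mesh_error_def diff_divide_distrib sum_subtractf)

lemma mesh_error_uminus: "mesh_error N h (\<lambda>y. - g y) \<omega> = - mesh_error N h g \<omega>"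
  by (simp add: mesh_error_def sum_negf)

text \<open>The absolute value is the maximum of two variables, the errors for \<open>g\<close> and
  \<open>- g\<close>, so the maximal inequality for two variables applies;
  \<open>ln 2 \<le> 2\<close> gives the round constant.\<close>

lemma expectation_abs_mesh_error:
  assumes h: "h < H" and N: "N \<ge> 1" and g: "g \<in> borel_measurable leb"
    and c: "\<And>y. y \<in> S \<Longrightarrow> \<bar>g y\<bar> \<le> c"
  shows "(\<integral>\<omega>. \<bar>mesh_error N h g \<omega>\<bar> \<partial>sample_law D b x0 N) \<le> 2 * (c / (\<delta> * sqrt (real N)))"
proof -
  interpret prob_space "sample_law D b x0 N" by (rule prob_space_sample)
  define v where "v = c / (\<delta> * sqrt (real N))"
  have c0: "c \<ge> 0" using c[OF x0] by simp
  then have v: "v \<ge> 0" using pos by (simp add: v_def)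
  define X where "X i = mesh_error N h (if i then g else (\<lambda>y. - g y))" for i
  have m: "(if i then g else (\<lambda>y. - g y)) \<in> borel_measurable leb"
    and le: "\<And>y. y \<in> S \<Longrightarrow> \<bar>(if i then g else (\<lambda>y. - g y)) y\<bar> \<le> c" for i
    using g c by auto
  have "expectation (\<lambda>\<omega>. Max ((\<lambda>i. X i \<omega>) ` {True, False})) \<le> sqrt (2 * v\<^sup>2 * ln (real (card {True, False})))"
  proof (rule expectation_Max_le)
    show "integrable (sample_law D b x0 N) (X i)" for i
      unfolding X_def by (rule mesh_error_integrable[OF h N m le])
    show "(\<integral>\<^sup>+\<omega>. ennreal (exp (l * X i \<omega>)) \<partial>sample_law D b x0 N) \<le> ennreal (exp (l\<^sup>2 * v\<^sup>2 / 2))"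
      if "l > 0" for i l
      unfolding X_def v_def using le by (intro mesh_error_mgf h N m c0 that AE_I2) auto
  qed auto
  moreover have "Max ((\<lambda>i. X i \<omega>) ` {True, False}) = \<bar>mesh_error N h g \<omega>\<bar>" for \<omega>
    by (simp add: X_def mesh_error_uminus)
  moreover have "sqrt (2 * v\<^sup>2 * ln (real (card {True, False}))) \<le> 2 * v"
  proof -
    have "ln 2 \<le> (2::real)" using ln_le_minus_one[of 2] by simp
    then have "2 * v\<^sup>2 * ln 2 \<le> 2 * v\<^sup>2 * 2" by (intro mult_left_mono) auto
    then have "2 * v\<^sup>2 * ln 2 \<le> (2 * v)\<^sup>2" by (simp add: power_mult_distrib)
    then show ?thesis using v by (intro real_le_lsqrt) auto
  qed
  ultimately show ?thesis unfolding v_def by simp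
qed


section \<open>Bellman recursion, mesh weights and the deterministic part of the error\<close>

lemma abs_integral_dens_le:
  assumes "h \<in> {1..H}" "x \<in> S" "a \<in> actions D"
    and f: "f \<in> borel_measurable leb" "\<And>y. y \<in> S \<Longrightarrow> \<bar>f y\<bar> \<le> c"
  shows "\<bar>\<integral>y. f y * dens D h x a y \<partial>leb\<bar> \<le> c"
proof -
  have [measurable]: "dens D h x a \<in> borel_measurable leb" using assms by (intro dens_meas)
  have "c \<ge> 0" using f(2)[OF x0] by simp
  have le: "\<bar>f y * dens D h x a y\<bar> \<le> c * dens D h x a y" if "y \<in> S" for y
    using f(2)[OF that] dens_nonneg[OF assms(1-3) that]
    by (simp add: abs_mult mult_right_mono)
  have int: "integrable leb (\<lambda>y. c * dens D h x a y)"
    using \<open>c \<ge> 0\<close> dens_bounds[OF assms(1-3)] dens_nonneg[OF assms(1-3)]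
    by (intro integrable_bounded[of _ "c * \<Lambda>"]) (auto simp: abs_mult intro: mult_left_mono)
  have "\<bar>\<integral>y. f y * dens D h x a y \<partial>leb\<bar> \<le> (\<integral>y. c * dens D h x a y \<partial>leb)"
  proof (rule order_trans[OF integral_abs_bound integral_mono[OF integrable_abs int]])
    show "integrable leb (\<lambda>y. f y * dens D h x a y)"
      using f(1) le by (intro Bochner_Integration.integrable_bound[OF int] AE_I2) (auto intro: order_trans[OF _ abs_ge_self])
  qed (use le in simp)
  then show ?thesis using integral_dens[OF assms(1-3)] by simp
qed

lemma optimal_value_final: "x \<in> S \<Longrightarrow> optimal_value D H x = final_reward D x"
  and optimal_value_step: "\<lbrakk>h < H; x \<in> S\<rbrakk> \<Longrightarrow> optimal_value D h x =
    (SUP a\<in>actions D. reward D h x a + (\<integral>z. optimal_value D (Suc h) z * dens D (Suc h) x a z \<partial>leb))"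
  and optimal_value_meas: "h \<le> H \<Longrightarrow> optimal_value D h \<in> borel_measurable leb"
  using regular by (auto simp: regular_data_def bellman_def)

text \<open>Backward induction along the Bellman equation: averaging against a density does not
  increase a bound, and each stage adds one reward. The extra 1 is the terminal reward.\<close>

lemma optimal_value_le:
  assumes "h \<le> H" "x \<in> S"
  shows "\<bar>optimal_value D h x\<bar> \<le> (real (H - h) + 1) * G"
  using assms
proof (induction h arbitrary: x rule: inc_induct)
  case base
  then show ?case using rewards_le[of 0 x "b 0"] b[of 0] H_pos by (simp add: optimal_value_final)
next
  case (step h)
  \<comment> \<open>Subtracting 0 allows \<open>abs_cSUP_diff_le\<close> to compare with the
    constant family 0, which takes care of boundedness as well.\<close>
  have "\<bar>reward D h x a + (\<integral>z. optimal_value D (Suc h) z * dens D (Suc h) x a z \<partial>leb) - 0\<bar>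
      \<le> (real (H - h) + 1) * G" if a: "a \<in> actions D" for a
  proof -
    have "\<bar>\<integral>z. optimal_value D (Suc h) z * dens D (Suc h) x a z \<partial>leb\<bar> \<le> (real (H - Suc h) + 1) * G"
      using step a by (intro abs_integral_dens_le optimal_value_meas) auto
    moreover have "real (H - h) = real (H - Suc h) + 1" using step by simp
    then have "(real (H - h) + 1) * G = G + (real (H - Suc h) + 1) * G" by (simp add: algebra_simps)
    moreover have "\<bar>reward D h x a\<bar> \<le> G" using rewards_le[of h x a] step a by simp
    ultimately show ?thesis by linarith
  qed
  then have "\<bar>(SUP a\<in>actions D. reward D h x a + (\<integral>z. optimal_value D (Suc h) z * dens D (Suc h) x a z \<partial>leb))
      - (SUP a\<in>actions D. 0)\<bar> \<le> (real (H - h) + 1) * G"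
    using actions_nonempty by (intro abs_cSUP_diff_le) auto
  then show ?case using step actions_nonempty by (simp add: optimal_value_step)
qed

text \<open>With the full sum \<open>Q = q n + Q'\<close>, the two quotients differ by
  \<open>p * q n / (Q * Q')\<close>. The numerator is at most \<open>\<Lambda>\<^sup>2\<close> and
  the denominator is quadratic in \<open>N\<close>, so the sum over the \<open>N\<close> chains is
  still of order \<open>1 / N\<close>.\<close>

lemma mesh_ratio_bounds:
  assumes h: "h < H" and N: "N \<ge> 2" and \<omega>: "\<And>n j. n \<in> {1..N} \<Longrightarrow> j \<le> H \<Longrightarrow> \<omega> n j \<in> S"
    and x: "x \<in> S" and a: "a \<in> actions D" and n: "n \<in> {1..N}"
  shows "0 < mesh_ratio D b N \<omega> h n x a"
    and "\<bar>mesh_ratio D b N \<omega> h n x a - dens D (Suc h) x a (\<omega> n (Suc h)) / mixture_density N h \<omega> (\<omega> n (Suc h))\<bar>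
      \<le> \<Lambda>\<^sup>2 / (\<delta>\<^sup>2 * (real N * (real N - 1)))"
proof -
  define y where "y = \<omega> n (Suc h)"
  define p where "p = dens D (Suc h) x a y"
  define q where "q k = dens D (Suc h) (\<omega> k h) (b h) y" for k
  define Q where "Q = mixture_density N h \<omega> y"
  define Q' where "Q' = (\<Sum>k\<in>{1..N} - {n}. q k)"
  have y: "y \<in> S" using \<omega> n h by (simp add: y_def)
  have p: "0 < p" "p \<le> \<Lambda>"
    using dens_bounds[of "Suc h" x a y] h x a y pos by (auto simp: p_def intro: less_le_trans)
  have q: "\<delta> \<le> q k" "q k \<le> \<Lambda>" if "k \<in> {1..N}" for k
    using dens_bounds[of "Suc h" "\<omega> k h" "b h" y] h b \<omega>[OF that, of h] y by (auto simp: q_def)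
  have "real (card ({1..N} - {n})) * \<delta> \<le> Q'"
    unfolding Q'_def using q by (intro sum_bounded_below) auto
  then have Q'_ge: "(real N - 1) * \<delta> \<le> Q'" using n N by (simp add: of_nat_diff)
  have Q_ge: "real N * \<delta> \<le> Q"
    unfolding Q_def using h \<omega> y by (intro mixture_density_ge) auto
  have QQ': "Q = q n + Q'"
    unfolding Q_def Q'_def mixture_density_def q_def[symmetric] using n by (intro sum.remove) auto
  have pos': "0 < (real N - 1) * \<delta>" "0 < real N * \<delta>" using N pos by auto
  then have Qp: "0 < Q'" "0 < Q" using Q'_ge Q_ge by linarith+
  have r: "mesh_ratio D b N \<omega> h n x a = p / Q'"
    by (simp add: mesh_ratio_def p_def Q'_def q_def y_def)
  show "0 < mesh_ratio D b N \<omega> h n x a" using r p Qp by simp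
  have "p / Q' - p / Q = p * q n / (Q * Q')"
    using Qp by (simp add: QQ' field_simps)
  moreover have "\<bar>p * q n / (Q * Q')\<bar> \<le> \<Lambda>\<^sup>2 / ((real N * \<delta>) * ((real N - 1) * \<delta>))"
  proof -
    have "0 \<le> q n" using q[OF n] pos by linarith
    then have "\<bar>p * q n / (Q * Q')\<bar> = p * q n / (Q * Q')" using p Qp by simp
    also have "\<dots> \<le> \<Lambda> * \<Lambda> / ((real N * \<delta>) * ((real N - 1) * \<delta>))"
      using p q[OF n] \<open>0 \<le> q n\<close> Q_ge Q'_ge pos' Qp pos N by (intro frac_le mult_mono mult_pos_pos) auto
    finally show ?thesis by (simp add: power2_eq_square)
  qed
  ultimately show "\<bar>mesh_ratio D b N \<omega> h n x a - dens D (Suc h) x a (\<omega> n (Suc h)) /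
      mixture_density N h \<omega> (\<omega> n (Suc h))\<bar> \<le> \<Lambda>\<^sup>2 / (\<delta>\<^sup>2 * (real N * (real N - 1)))"
    by (simp add: r p_def Q_def y_def power2_eq_square mult_ac)
qed

text \<open>For \<open>N \<ge> 2\<close> every leave-one-out sum is nonempty and all ratios are
  positive, so the convention for division by zero never takes effect.\<close>

lemma mesh_weight_props:
  assumes "h < H" "N \<ge> 2" "\<And>n j. n \<in> {1..N} \<Longrightarrow> j \<le> H \<Longrightarrow> \<omega> n j \<in> S" "x \<in> S" "a \<in> actions D"
  shows "\<And>n. n \<in> {1..N} \<Longrightarrow> 0 \<le> mesh_weight D b N \<omega> h n x a"
    and "(\<Sum>n\<in>{1..N}. mesh_weight D b N \<omega> h n x a) = 1"
proof -
  have r: "0 < mesh_ratio D b N \<omega> h n x a" if "n \<in> {1..N}" for n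
    using assms that by (intro mesh_ratio_bounds) auto
  have s: "0 < (\<Sum>n\<in>{1..N}. mesh_ratio D b N \<omega> h n x a)"
    using r assms(2) by (intro sum_pos) auto
  show "0 \<le> mesh_weight D b N \<omega> h n x a" if "n \<in> {1..N}" for n
    unfolding mesh_weight_def using r[OF that] s by simp
  show "(\<Sum>n\<in>{1..N}. mesh_weight D b N \<omega> h n x a) = 1"
    unfolding mesh_weight_def using s by (simp add: sum_divide_distrib[symmetric])
qed

text \<open>Numerator \<open>A\<close> and normaliser \<open>B\<close> are full-sum estimators of
  \<open>I\<close> and 1, up to the leave-one-out corrections \<open>e n\<close>. Each correction
  costs at most \<open>c * \<kappa>\<close>, once for \<open>A\<close> and once, multiplied by the
  bound on \<open>A / B\<close>, for \<open>B\<close>. The factor 1 in the second process shows it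
  to be the first one for the constant function 1.\<close>

lemma mesh_step_error:
  assumes h: "h < H" and N: "N \<ge> 2" and \<omega>: "\<And>n j. n \<in> {1..N} \<Longrightarrow> j \<le> H \<Longrightarrow> \<omega> n j \<in> S"
    and x: "x \<in> S" and a: "a \<in> actions D"
    and f: "\<And>y. y \<in> S \<Longrightarrow> \<bar>f y\<bar> \<le> c"
  shows "\<bar>(\<Sum>n\<in>{1..N}. f (\<omega> n (Suc h)) * mesh_weight D b N \<omega> h n x a)
      - (\<integral>y. f y * dens D (Suc h) x a y \<partial>leb)\<bar>
    \<le> \<bar>mesh_error N h (\<lambda>y. f y * dens D (Suc h) x a y) \<omega>\<bar>
      + c * \<bar>mesh_error N h (\<lambda>y. 1 * dens D (Suc h) x a y) \<omega>\<bar>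
      + 2 * (c * (\<Lambda>\<^sup>2 / (\<delta>\<^sup>2 * (real N - 1))))"
proof -
  define y where "y n = \<omega> n (Suc h)" for n
  define r where "r n = mesh_ratio D b N \<omega> h n x a" for n
  define e where "e n = r n - dens D (Suc h) x a (y n) / mixture_density N h \<omega> (y n)" for n
  define \<kappa> where "\<kappa> = \<Lambda>\<^sup>2 / (\<delta>\<^sup>2 * (real N - 1))"
  have y: "y n \<in> S" if "n \<in> {1..N}" for n using \<omega>[OF that, of "Suc h"] h by (simp add: y_def)
  have c: "c \<ge> 0" using f[OF x0] by simp
  have r: "0 < r n" and e: "\<bar>e n\<bar> \<le> \<kappa> / real N" if "n \<in> {1..N}" for n
    using mesh_ratio_bounds[OF h N \<omega> x a that] by (simp_all add: r_def e_def y_def \<kappa>_def mult_ac)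
  have sum_e: "\<bar>\<Sum>n\<in>{1..N}. g (y n) * e n\<bar> \<le> c' * \<kappa>"
    if g: "\<And>y. y \<in> S \<Longrightarrow> \<bar>g y\<bar> \<le> c'" and "c' \<ge> 0" for g c'
  proof -
    have "\<bar>\<Sum>n\<in>{1..N}. g (y n) * e n\<bar> \<le> (\<Sum>n\<in>{1..N}. c' * (\<kappa> / real N))"
    proof (intro order_trans[OF sum_abs] sum_mono)
      fix n assume n: "n \<in> {1..N}"
      show "\<bar>g (y n) * e n\<bar> \<le> c' * (\<kappa> / real N)"
        unfolding abs_mult using g[OF y[OF n]] e[OF n] \<open>c' \<ge> 0\<close> by (intro mult_mono) auto
    qed
    then show ?thesis using N by simp
  qed
  define A where "A = (\<Sum>n\<in>{1..N}. f (y n) * r n)"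
  define B where "B = (\<Sum>n\<in>{1..N}. r n)"
  have B: "B > 0" unfolding B_def using r N by (intro sum_pos) auto
  have "\<bar>A\<bar> \<le> (\<Sum>n\<in>{1..N}. c * r n)"
    unfolding A_def
  proof (intro order_trans[OF sum_abs] sum_mono)
    fix n assume n: "n \<in> {1..N}"
    show "\<bar>f (y n) * r n\<bar> \<le> c * r n"
      unfolding abs_mult using f[OF y[OF n]] r[OF n] by (intro mult_mono) auto
  qed
  then have "\<bar>A\<bar> \<le> c * B" unfolding B_def sum_distrib_left .
  then have AB: "\<bar>A / B\<bar> \<le> c" using B by (simp add: pos_divide_le_eq)
  define I where "I = (\<integral>y. f y * dens D (Suc h) x a y \<partial>leb)"
  have "A - I = mesh_error N h (\<lambda>y. f y * dens D (Suc h) x a y) \<omega> + (\<Sum>n\<in>{1..N}. f (y n) * e n)"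
    by (simp add: mesh_error_def A_def I_def e_def y_def right_diff_distrib sum_subtractf)
  then have AI: "\<bar>A - I\<bar> \<le> \<bar>mesh_error N h (\<lambda>y. f y * dens D (Suc h) x a y) \<omega>\<bar> + c * \<kappa>"
    using sum_e[of f c, OF f c] by linarith
  have "B - 1 = mesh_error N h (\<lambda>y. 1 * dens D (Suc h) x a y) \<omega> + (\<Sum>n\<in>{1..N}. 1 * e n)"
    using integral_dens[of "Suc h" x a] h x a
    by (simp add: mesh_error_def B_def e_def y_def sum_subtractf)
  then have "\<bar>1 - B\<bar> \<le> \<bar>mesh_error N h (\<lambda>y. 1 * dens D (Suc h) x a y) \<omega>\<bar> + 1 * \<kappa>"
    using sum_e[of "\<lambda>_. 1" 1] by simp
  then have "\<bar>A / B\<bar> * \<bar>1 - B\<bar> \<le> c * (\<bar>mesh_error N h (\<lambda>y. 1 * dens D (Suc h) x a y) \<omega>\<bar> + 1 * \<kappa>)"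
    using AB c by (intro mult_mono) auto
  \<comment> \<open>This decomposition keeps \<open>A / B\<close>, which is bounded by
    \<open>c\<close> as a weighted average, so that \<open>B\<close> is never divided out of an
    error term.\<close>
  moreover have "A / B - I = (A / B) * (1 - B) + (A - I)" using B by (simp add: field_simps)
  then have "\<bar>A / B - I\<bar> \<le> \<bar>A / B\<bar> * \<bar>1 - B\<bar> + \<bar>A - I\<bar>"
    by (metis abs_mult abs_triangle_ineq)
  moreover have "(\<Sum>n\<in>{1..N}. f (\<omega> n (Suc h)) * mesh_weight D b N \<omega> h n x a) = A / B"
    by (simp add: mesh_weight_def A_def B_def r_def y_def sum_divide_distrib)
  ultimately show ?thesis using AI unfolding \<kappa>_def[symmetric] I_def[symmetric] by (simp add: algebra_simps)
qed

text \<open>Averaging with weights of total mass 1 does not amplify the error of the next stage, so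
  one-step errors add instead of multiplying. The sample is fixed here; \<open>E\<close> must cover
  all states because the recursion reaches states that depend on the sample.\<close>

lemma mesh_value_error:
  assumes N: "N \<ge> 2" and \<omega>: "\<And>n j. n \<in> {1..N} \<Longrightarrow> j \<le> H \<Longrightarrow> \<omega> n j \<in> S"
    and E: "\<And>j x a. j < H \<Longrightarrow> x \<in> S \<Longrightarrow> a \<in> actions D \<Longrightarrow>
      \<bar>(\<Sum>n\<in>{1..N}. optimal_value D (Suc j) (\<omega> n (Suc j)) * mesh_weight D b N \<omega> j n x a)
        - (\<integral>y. optimal_value D (Suc j) y * dens D (Suc j) x a y \<partial>leb)\<bar> \<le> E j"
    and "h \<le> H" "x \<in> S"
  shows "\<bar>mesh_value D b N \<omega> h x - optimal_value D h x\<bar> \<le> (\<Sum>j\<in>{h..<H}. E j)"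
  using assms(4,5)
proof (induction h arbitrary: x rule: inc_induct)
  case base
  then show ?case by (simp add: mesh_value.simps optimal_value_final)
next
  case (step h)
  let ?V = "optimal_value D (Suc h)" and ?W = "mesh_value D b N \<omega> (Suc h)"
  let ?w = "\<lambda>n a. mesh_weight D b N \<omega> h n x a"
  have "\<bar>(reward D h x a + (\<Sum>n\<in>{1..N}. ?W (\<omega> n (Suc h)) * ?w n a)) -
      (reward D h x a + (\<integral>y. ?V y * dens D (Suc h) x a y \<partial>leb))\<bar> \<le> (\<Sum>j\<in>{h..<H}. E j)"
    if a: "a \<in> actions D" for a
  proof -
    have w: "\<And>n. n \<in> {1..N} \<Longrightarrow> 0 \<le> ?w n a" "(\<Sum>n\<in>{1..N}. ?w n a) = 1"
      using mesh_weight_props[OF step(2) N \<omega> step.prems a] by auto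
    have "\<bar>\<Sum>n\<in>{1..N}. (?W (\<omega> n (Suc h)) - ?V (\<omega> n (Suc h))) * ?w n a\<bar> \<le>
        (\<Sum>n\<in>{1..N}. (\<Sum>j\<in>{Suc h..<H}. E j) * ?w n a)"
    proof (intro order_trans[OF sum_abs] sum_mono)
      fix n assume n: "n \<in> {1..N}"
      have "\<omega> n (Suc h) \<in> S" using \<omega>[OF n, of "Suc h"] step(2) by simp
      then show "\<bar>(?W (\<omega> n (Suc h)) - ?V (\<omega> n (Suc h))) * ?w n a\<bar> \<le> (\<Sum>j\<in>{Suc h..<H}. E j) * ?w n a"
        using step.IH w(1)[OF n] by (simp add: abs_mult mult_right_mono)
    qed
    also have "\<dots> = (\<Sum>j\<in>{Suc h..<H}. E j)" by (simp only: sum_distrib_left[symmetric] w mult_1_right)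
    finally have "\<bar>(\<Sum>n\<in>{1..N}. ?W (\<omega> n (Suc h)) * ?w n a) - (\<Sum>n\<in>{1..N}. ?V (\<omega> n (Suc h)) * ?w n a)\<bar>
        \<le> (\<Sum>j\<in>{Suc h..<H}. E j)"
      by (simp add: left_diff_distrib sum_subtractf)
    moreover note E[OF step(2) step.prems a]
    moreover have "(\<Sum>j\<in>{h..<H}. E j) = E h + (\<Sum>j\<in>{Suc h..<H}. E j)"
      using step(2) by (rule sum.atLeast_Suc_lessThan)
    ultimately show ?thesis by linarith
  qed
  \<comment> \<open>Only the exact Bellman family is bounded explicitly; for the mesh family
    boundedness comes out of \<open>abs_cSUP_diff_le\<close>.\<close>
  moreover have "bdd_above ((\<lambda>a. reward D h x a + (\<integral>y. ?V y * dens D (Suc h) x a y \<partial>leb)) ` actions D)"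
  proof (rule bdd_aboveI2)
    fix a assume a: "a \<in> actions D"
    have "\<bar>\<integral>y. ?V y * dens D (Suc h) x a y \<partial>leb\<bar> \<le> (real (H - Suc h) + 1) * G"
      using step a by (intro abs_integral_dens_le optimal_value_meas optimal_value_le) auto
    then show "reward D h x a + (\<integral>y. ?V y * dens D (Suc h) x a y \<partial>leb) \<le> G + (real (H - Suc h) + 1) * G"
      using rewards_le[of h x a] step a by linarith
  qed
  ultimately show ?case
    using abs_cSUP_diff_le[OF actions_nonempty] step(2) step.prems
    by (simp add: mesh_value.simps[of D b N \<omega> h] optimal_value_step)
qed


section \<open>Uniform bounds over states and actions\<close>

lemma mesh_process_bound:
  assumes h: "h < H" and N: "N \<ge> 1" and f[measurable]: "f \<in> borel_measurable leb"
    and fc: "\<And>y. y \<in> S \<Longrightarrow> \<bar>f y\<bar> \<le> c" and DI: "dudley_integral SA = ennreal d" and "d \<ge> 0"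
  shows "\<exists>W. integrable (sample_law D b x0 N) W \<and>
    (AE \<omega> in sample_law D b x0 N. \<forall>x\<in>S. \<forall>a\<in>actions D.
      \<bar>mesh_error N h (\<lambda>y. f y * dens D (Suc h) x a y) \<omega>\<bar> \<le> W \<omega>) \<and>
    (\<integral>\<omega>. W \<omega> \<partial>sample_law D b x0 N) \<le> c / sqrt (real N) * (12 * L * d / \<delta> + 3 * \<Lambda> / \<delta>)"
proof -
  interpret prob_space "sample_law D b x0 N" by (rule prob_space_sample)
  have c: "c \<ge> 0" using fc[OF x0] by simp
  have sN: "sqrt (real N) > 0" using N by simp
  define g where "g t = (\<lambda>y. f y * dens D (Suc h) (fst t) (snd t) y)" for t
  define Z where "Z t = mesh_error N h (g t)" for t
  define \<sigma> where "\<sigma> = c * L / (\<delta> * sqrt (real N))"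
  \<comment> \<open>Chosen so that the pathwise discretisation error
    \<open>2 * (c * L * \<epsilon>) / \<delta>\<close> equals
    \<open>c * \<Lambda> / (\<delta> * sqrt N)\<close>, the scale of the fluctuations at a single
    point.\<close>
  define \<epsilon> where "\<epsilon> = \<Lambda> / (2 * L * sqrt (real N))"
  have \<sigma>: "\<sigma> \<ge> 0" and \<epsilon>: "\<epsilon> > 0" using c pos sN by (simp_all add: \<sigma>_def \<epsilon>_def)
  have h1: "Suc h \<in> {1..H}" using h by simp
  have g_meas[measurable]: "g t \<in> borel_measurable leb" if "t \<in> mspace SA" for t
  proof -
    have [measurable]: "dens D (Suc h) (fst t) (snd t) \<in> borel_measurable leb"
      using that h1 by (intro dens_meas) auto
    show ?thesis unfolding g_def by measurable
  qed
  have g_le: "\<bar>g t y\<bar> \<le> c * \<Lambda>" if "t \<in> mspace SA" "y \<in> S" for t y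
  proof -
    have "0 \<le> dens D (Suc h) (fst t) (snd t) y" "dens D (Suc h) (fst t) (snd t) y \<le> \<Lambda>"
      using dens_nonneg[OF h1] dens_bounds[OF h1] that by auto
    then show ?thesis unfolding g_def abs_mult using fc[OF that(2)] c by (intro mult_mono) auto
  qed
  have g_lip: "\<bar>g s y - g t y\<bar> \<le> c * L * mdist SA s t"
    if "s \<in> mspace SA" "t \<in> mspace SA" "y \<in> S" "\<L> y \<le> L" for s t y
  proof -
    obtain x a x' a' where st: "s = (x, a)" "t = (x', a')" by (cases s, cases t)
    have "\<bar>dens D (Suc h) x a y - dens D (Suc h) x' a' y\<bar> \<le> \<L> y * mdist SA s t"
      using dens_lipschitz[OF h1, of x x' a a' y] that by (simp add: st mdist_SA)
    also have "\<dots> \<le> L * mdist SA s t" using that by (intro mult_right_mono) auto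
    finally have "\<bar>f y\<bar> * \<bar>dens D (Suc h) x a y - dens D (Suc h) x' a' y\<bar> \<le> c * (L * mdist SA s t)"
      using fc[OF that(3)] c by (intro mult_mono) auto
    then show ?thesis by (simp add: g_def st abs_mult[symmetric] right_diff_distrib)
  qed
  have g_lip_AE: "AE y in leb. \<bar>g s y - g t y\<bar> \<le> c * L * mdist SA s t"
    if "s \<in> mspace SA" "t \<in> mspace SA" for s t
    using AE_\<L>_le AE_space by eventually_elim (use g_lip that in simp)
  have cL: "0 \<le> c * L * mdist SA s t" for s t using c pos by simp
  have Z_diff: "Z s \<omega> - Z t \<omega> = mesh_error N h (\<lambda>y. g s y - g t y) \<omega>"
    if "s \<in> mspace SA" "t \<in> mspace SA" for s t \<omega>
    unfolding Z_def using that by (intro mesh_error_diff integrable_bounded[OF g_meas g_le])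
  have Z_int: "integrable (sample_law D b x0 N) (Z t)" if "t \<in> mspace SA" for t
    unfolding Z_def by (rule mesh_error_integrable[OF h N g_meas[OF that] g_le[OF that]])
  have mgf: "(\<integral>\<^sup>+\<omega>. ennreal (exp (l * (Z s \<omega> - Z t \<omega>))) \<partial>sample_law D b x0 N)
      \<le> ennreal (exp (l\<^sup>2 * (\<sigma> * mdist SA s t)\<^sup>2 / 2))"
    if st: "s \<in> mspace SA" "t \<in> mspace SA" and l: "l > 0" for s t l
  proof -
    have "(\<lambda>y. g s y - g t y) \<in> borel_measurable leb" using st by measurable
    from mesh_error_mgf[OF h N this g_lip_AE[OF st] cL l] show ?thesis
      by (simp add: Z_diff[OF st] \<sigma>_def mult_ac)
  qed
  have ne: "mspace SA \<noteq> {}" using x0 actions_nonempty by auto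
  have "\<exists>T W. finite T \<and> T \<noteq> {} \<and> T \<subseteq> mspace SA \<and> (\<forall>t\<in>mspace SA. \<exists>s\<in>T. mdist SA s t \<le> \<epsilon>) \<and>
      integrable (sample_law D b x0 N) W \<and> (\<forall>s\<in>T. \<forall>t\<in>T. \<forall>\<omega>. \<bar>Z s \<omega> - Z t \<omega>\<bar> \<le> W \<omega>) \<and>
      ennreal (expectation W) \<le> ennreal (12 * \<sigma>) * dudley_integral SA"
    by (rule dudley[OF totally_bounded_SA ne \<sigma> \<epsilon> Z_int mgf])
  then obtain T W where T: "T \<noteq> {}" "T \<subseteq> mspace SA" "\<forall>t\<in>mspace SA. \<exists>s\<in>T. mdist SA s t \<le> \<epsilon>"
    and W: "integrable (sample_law D b x0 N) W" "\<forall>s\<in>T. \<forall>t\<in>T. \<forall>\<omega>. \<bar>Z s \<omega> - Z t \<omega>\<bar> \<le> W \<omega>"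
      "ennreal (expectation W) \<le> ennreal (12 * \<sigma>) * dudley_integral SA"
    by (elim exE conjE) (rule that)
  obtain t0 where t0: "t0 \<in> T" using T by auto
  have t0': "t0 \<in> mspace SA" using t0 T by auto
  \<comment> \<open>Three contributions: the oscillation of the process on the net, its value at one
    base point, and the gap between the space and the net. The last two account for
    \<open>3 * \<Lambda> / \<delta>\<close>, namely 2 for the base point and 1 for the gap.\<close>
  define W' where "W' \<omega> = W \<omega> + \<bar>Z t0 \<omega>\<bar> + c * \<Lambda> / (\<delta> * sqrt (real N))" for \<omega>
  have "AE \<omega> in sample_law D b x0 N. \<forall>x\<in>S. \<forall>a\<in>actions D.
      \<bar>mesh_error N h (\<lambda>y. f y * dens D (Suc h) x a y) \<omega>\<bar> \<le> W' \<omega>"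
    using AE_sample_\<L>_le AE_space
  proof eventually_elim
    case (elim \<omega>)
    show ?case
    proof (intro ballI)
      fix x a assume "x \<in> S" "a \<in> actions D"
      then have t: "(x, a) \<in> mspace SA" by simp
      then obtain s where s: "s \<in> T" "mdist SA s (x, a) \<le> \<epsilon>" using T(3) by blast
      have s': "s \<in> mspace SA" using s T by auto
      have "\<bar>mesh_error N h (\<lambda>y. g (x, a) y - g s y) \<omega>\<bar> \<le> 2 * (c * L * mdist SA (x, a) s) / \<delta>"
      proof (rule mesh_error_le[OF h N])
        show "\<bar>g (x, a) (\<omega> n (Suc h)) - g s (\<omega> n (Suc h))\<bar> \<le> c * L * mdist SA (x, a) s"
          if n: "n \<in> {1..N}" for n
        proof (rule g_lip[OF t s'])
          show "\<omega> n (Suc h) \<in> S" using space_sampleD[OF elim(2) n, of "Suc h"] h by simp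
          show "\<L> (\<omega> n (Suc h)) \<le> L" using elim(1) n h by blast
        qed
      qed (use space_sampleD[OF elim(2)] g_meas[OF t] g_meas[OF s'] g_lip_AE[OF t s'] cL in auto)
      also have "\<dots> \<le> 2 * (c * L * \<epsilon>) / \<delta>"
        using s(2) c pos by (intro divide_right_mono mult_left_mono) (auto simp: mdist_commute)
      also have "\<dots> = c * \<Lambda> / (\<delta> * sqrt (real N))" using pos by (simp add: \<epsilon>_def field_simps)
      finally have "\<bar>Z (x, a) \<omega> - Z s \<omega>\<bar> \<le> c * \<Lambda> / (\<delta> * sqrt (real N))" by (simp add: Z_diff[OF t s'])
      moreover have "\<bar>Z s \<omega> - Z t0 \<omega>\<bar> \<le> W \<omega>" using W(2) s t0 by blast
      ultimately have "\<bar>Z (x, a) \<omega>\<bar> \<le> W' \<omega>" unfolding W'_def by linarith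
      then show "\<bar>mesh_error N h (\<lambda>y. f y * dens D (Suc h) x a y) \<omega>\<bar> \<le> W' \<omega>"
        by (simp add: Z_def g_def)
    qed
  qed
  moreover have "integrable (sample_law D b x0 N) W'"
    unfolding W'_def using W(1) Z_int[OF t0'] by simp
  moreover have "expectation W' \<le> c / sqrt (real N) * (12 * L * d / \<delta> + 3 * \<Lambda> / \<delta>)"
  proof -
    have "ennreal (expectation W) \<le> ennreal (12 * \<sigma> * d)"
      using W(3) \<sigma> \<open>d \<ge> 0\<close> by (simp add: DI ennreal_mult)
    then have "expectation W \<le> 12 * \<sigma> * d" using \<sigma> \<open>d \<ge> 0\<close> by (subst (asm) ennreal_le_iff) auto
    moreover have "expectation (\<lambda>\<omega>. \<bar>Z t0 \<omega>\<bar>) \<le> 2 * (c * \<Lambda> / (\<delta> * sqrt (real N)))"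
      unfolding Z_def by (rule expectation_abs_mesh_error[OF h N g_meas[OF t0'] g_le[OF t0']])
    moreover have "expectation W' = expectation W + expectation (\<lambda>\<omega>. \<bar>Z t0 \<omega>\<bar>) + c * \<Lambda> / (\<delta> * sqrt (real N))"
      unfolding W'_def using W(1) Z_int[OF t0'] by (simp add: prob_space)
    ultimately have "expectation W' \<le> 12 * \<sigma> * d + 3 * (c * \<Lambda> / (\<delta> * sqrt (real N)))" by linarith
    also have "\<dots> = c / sqrt (real N) * (12 * L * d / \<delta> + 3 * \<Lambda> / \<delta>)"
      using sN pos by (simp add: \<sigma>_def field_simps)
    finally show ?thesis .
  qed
  ultimately show ?thesis by blast
qed

lemma mesh_step_error_bound:
  assumes h: "h < H" and N: "N \<ge> 2" and f: "f \<in> borel_measurable leb"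
    and fc: "\<And>y. y \<in> S \<Longrightarrow> \<bar>f y\<bar> \<le> c" and DI: "dudley_integral SA = ennreal d" and d: "d \<ge> 0"
  shows "\<exists>E. integrable (sample_law D b x0 N) E \<and>
    (AE \<omega> in sample_law D b x0 N. \<forall>x\<in>S. \<forall>a\<in>actions D.
      \<bar>(\<Sum>n\<in>{1..N}. f (\<omega> n (Suc h)) * mesh_weight D b N \<omega> h n x a)
        - (\<integral>y. f y * dens D (Suc h) x a y \<partial>leb)\<bar> \<le> E \<omega>) \<and>
    (\<integral>\<omega>. E \<omega> \<partial>sample_law D b x0 N) \<le> 24 * (c / sqrt (real N) * ((L * d + \<Lambda>) / \<delta> + \<Lambda>\<^sup>2 / \<delta>\<^sup>2))"
proof -
  interpret prob_space "sample_law D b x0 N" by (rule prob_space_sample)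
  have c: "c \<ge> 0" using fc[OF x0] by simp
  have N1: "N \<ge> 1" using N by simp
  define B where "B = 12 * L * d / \<delta> + 3 * \<Lambda> / \<delta>"
  define \<kappa> where "\<kappa> = \<Lambda>\<^sup>2 / (\<delta>\<^sup>2 * (real N - 1))"
  obtain W where W: "integrable (sample_law D b x0 N) W"
    "AE \<omega> in sample_law D b x0 N. \<forall>x\<in>S. \<forall>a\<in>actions D.
      \<bar>mesh_error N h (\<lambda>y. f y * dens D (Suc h) x a y) \<omega>\<bar> \<le> W \<omega>"
    "expectation W \<le> c / sqrt (real N) * B"
    using mesh_process_bound[OF h N1 f fc DI d] unfolding B_def by blast
  obtain U where U: "integrable (sample_law D b x0 N) U"
    "AE \<omega> in sample_law D b x0 N. \<forall>x\<in>S. \<forall>a\<in>actions D.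
      \<bar>mesh_error N h (\<lambda>y. 1 * dens D (Suc h) x a y) \<omega>\<bar> \<le> U \<omega>"
    "expectation U \<le> 1 / sqrt (real N) * B"
    using mesh_process_bound[OF h N1 _ _ DI d, of "\<lambda>_. 1" 1] unfolding B_def by auto
  define E where "E \<omega> = W \<omega> + c * U \<omega> + 2 * (c * \<kappa>)" for \<omega>
  have "AE \<omega> in sample_law D b x0 N. \<forall>x\<in>S. \<forall>a\<in>actions D.
      \<bar>(\<Sum>n\<in>{1..N}. f (\<omega> n (Suc h)) * mesh_weight D b N \<omega> h n x a)
        - (\<integral>y. f y * dens D (Suc h) x a y \<partial>leb)\<bar> \<le> E \<omega>"
    using W(2) U(2) AE_space
  proof eventually_elim
    case (elim \<omega>)
    show ?case
    proof (intro ballI)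
      fix x a assume xa: "x \<in> S" "a \<in> actions D"
      have "\<bar>mesh_error N h (\<lambda>y. f y * dens D (Suc h) x a y) \<omega>\<bar> \<le> W \<omega>"
        "c * \<bar>mesh_error N h (\<lambda>y. 1 * dens D (Suc h) x a y) \<omega>\<bar> \<le> c * U \<omega>"
        using elim xa c by (auto intro: mult_left_mono)
      with mesh_step_error[where f = f and \<omega> = \<omega>, OF h N space_sampleD[OF elim(3)] xa fc]
      show "\<bar>(\<Sum>n\<in>{1..N}. f (\<omega> n (Suc h)) * mesh_weight D b N \<omega> h n x a)
          - (\<integral>y. f y * dens D (Suc h) x a y \<partial>leb)\<bar> \<le> E \<omega>"
        unfolding E_def \<kappa>_def by linarith
    qed
  qed
  moreover have "integrable (sample_law D b x0 N) E" unfolding E_def using W(1) U(1) by simp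
  moreover have "expectation E \<le> 24 * (c / sqrt (real N) * ((L * d + \<Lambda>) / \<delta> + \<Lambda>\<^sup>2 / \<delta>\<^sup>2))"
  proof -
    have "expectation E = expectation W + c * expectation U + 2 * (c * \<kappa>)"
      unfolding E_def using W(1) U(1) by (simp add: prob_space)
    also have "c * expectation U \<le> c * (1 / sqrt (real N) * B)" using U(3) c by (rule mult_left_mono)
    \<comment> \<open>The leave-one-out correction is of order \<open>1 / N\<close>. Since
      \<open>N \<le> 2 * (N - 1)\<close> already for \<open>N \<ge> 2\<close>, it is absorbed into
      the rate \<open>1 / sqrt N\<close> without a threshold on \<open>N\<close>.\<close>
    also have "\<kappa> \<le> 2 / sqrt (real N) * (\<Lambda>\<^sup>2 / \<delta>\<^sup>2)"
    proof -
      have "sqrt (real N) \<le> real N" using N by (intro real_le_lsqrt) (auto simp: power2_eq_square)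
      also have "real N \<le> 2 * (real N - 1)" using N by simp
      finally have "1 / (real N - 1) \<le> 2 / sqrt (real N)" using N by (simp add: field_simps)
      then have "1 / (real N - 1) * (\<Lambda>\<^sup>2 / \<delta>\<^sup>2) \<le> 2 / sqrt (real N) * (\<Lambda>\<^sup>2 / \<delta>\<^sup>2)"
        by (rule mult_right_mono) simp
      then show ?thesis by (simp add: \<kappa>_def mult.commute)
    qed
    also note W(3)
    finally have "expectation E \<le> c / sqrt (real N) * B + c * (1 / sqrt (real N) * B)
        + 2 * (c * (2 / sqrt (real N) * (\<Lambda>\<^sup>2 / \<delta>\<^sup>2)))"
      using c by (simp add: mult_left_mono)
    also have "\<dots> = c / sqrt (real N) * (2 * B + 4 * (\<Lambda>\<^sup>2 / \<delta>\<^sup>2))" by (simp add: algebra_simps)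
    also have "\<dots> \<le> c / sqrt (real N) * (24 * ((L * d + \<Lambda>) / \<delta> + \<Lambda>\<^sup>2 / \<delta>\<^sup>2))"
    proof (rule mult_left_mono)
      \<comment> \<open>In these terms the claim is
        \<open>24 * u + 6 * v + 4 * w \<le> 24 * (u + v + w)\<close>; the 24 is twice the chaining
        constant, one for each of the two processes.\<close>
      define u v w where "u = L * d / \<delta>" "v = \<Lambda> / \<delta>" "w = \<Lambda>\<^sup>2 / \<delta>\<^sup>2"
      have "B = 12 * u + 3 * v" "(L * d + \<Lambda>) / \<delta> = u + v" "0 \<le> v" "0 \<le> w"
        using pos by (simp_all add: B_def u_v_w_def add_divide_distrib)
      then show "2 * B + 4 * (\<Lambda>\<^sup>2 / \<delta>\<^sup>2) \<le> 24 * ((L * d + \<Lambda>) / \<delta> + \<Lambda>\<^sup>2 / \<delta>\<^sup>2)"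
        unfolding u_v_w_def(3)[symmetric] by simp
    qed (use c in simp)
    finally show ?thesis by (simp add: mult_ac)
  qed
  ultimately show ?thesis by blast
qed

section \<open>The expected total error\<close>

lemma mesh_convergence_finite:
  assumes N: "N \<ge> 2" and DI: "dudley_integral SA = ennreal d" and d: "d \<ge> 0"
  shows "(\<integral>\<^sup>+\<omega>. ennreal \<bar>mesh_value D b N \<omega> 0 x0 - optimal_value D 0 x0\<bar> \<partial>sample_law D b x0 N)
    \<le> ennreal (24 * ((real H)\<^sup>2 * G / sqrt (real N)) * ((L * d + \<Lambda>) / \<delta> + \<Lambda>\<^sup>2 / \<delta>\<^sup>2))"
proof -
  interpret prob_space "sample_law D b x0 N" by (rule prob_space_sample)
  define R where "R = (L * d + \<Lambda>) / \<delta> + \<Lambda>\<^sup>2 / \<delta>\<^sup>2"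
  have R: "R \<ge> 0" using pos d by (simp add: R_def)
  have "\<forall>j. \<exists>E. j < H \<longrightarrow> integrable (sample_law D b x0 N) E \<and>
    (AE \<omega> in sample_law D b x0 N. \<forall>x\<in>S. \<forall>a\<in>actions D.
      \<bar>(\<Sum>n\<in>{1..N}. optimal_value D (Suc j) (\<omega> n (Suc j)) * mesh_weight D b N \<omega> j n x a)
        - (\<integral>y. optimal_value D (Suc j) y * dens D (Suc j) x a y \<partial>leb)\<bar> \<le> E \<omega>) \<and>
    expectation E \<le> 24 * ((real H * G) / sqrt (real N) * R)"
  proof
    fix j
    show "\<exists>E. j < H \<longrightarrow> integrable (sample_law D b x0 N) E \<and>
      (AE \<omega> in sample_law D b x0 N. \<forall>x\<in>S. \<forall>a\<in>actions D.
        \<bar>(\<Sum>n\<in>{1..N}. optimal_value D (Suc j) (\<omega> n (Suc j)) * mesh_weight D b N \<omega> j n x a)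
          - (\<integral>y. optimal_value D (Suc j) y * dens D (Suc j) x a y \<partial>leb)\<bar> \<le> E \<omega>) \<and>
      expectation E \<le> 24 * ((real H * G) / sqrt (real N) * R)"
    proof (cases "j < H")
      case True
      \<comment> \<open>The function averaged at stage \<open>j\<close> is the value at time
        \<open>j + 1\<close>, so its bound is \<open>(H - j) * G\<close>. Replacing it by
        \<open>H * G\<close> and summing over \<open>H\<close> stages yields the factor
        \<open>H\<^sup>2 * G\<close>.\<close>
      have "\<bar>optimal_value D (Suc j) y\<bar> \<le> real H * G" if "y \<in> S" for y
      proof -
        have "\<bar>optimal_value D (Suc j) y\<bar> \<le> (real (H - Suc j) + 1) * G"
          using True that by (intro optimal_value_le) auto
        also have "\<dots> \<le> real H * G" using True pos by (intro mult_right_mono) auto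
        finally show ?thesis .
      qed
      with True mesh_step_error_bound[OF True N optimal_value_meas _ DI d, of "Suc j" "real H * G"]
      show ?thesis unfolding R_def by auto
    qed simp
  qed
  then obtain E where E: "\<And>j. j < H \<Longrightarrow> integrable (sample_law D b x0 N) (E j)"
    "\<And>j. j < H \<Longrightarrow> AE \<omega> in sample_law D b x0 N. \<forall>x\<in>S. \<forall>a\<in>actions D.
      \<bar>(\<Sum>n\<in>{1..N}. optimal_value D (Suc j) (\<omega> n (Suc j)) * mesh_weight D b N \<omega> j n x a)
        - (\<integral>y. optimal_value D (Suc j) y * dens D (Suc j) x a y \<partial>leb)\<bar> \<le> E j \<omega>"
    "\<And>j. j < H \<Longrightarrow> expectation (E j) \<le> 24 * ((real H * G) / sqrt (real N) * R)"
    by (rule choice[THEN exE]) blast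
  have "AE \<omega> in sample_law D b x0 N. \<forall>j\<in>{..<H}. \<forall>x\<in>S. \<forall>a\<in>actions D.
      \<bar>(\<Sum>n\<in>{1..N}. optimal_value D (Suc j) (\<omega> n (Suc j)) * mesh_weight D b N \<omega> j n x a)
        - (\<integral>y. optimal_value D (Suc j) y * dens D (Suc j) x a y \<partial>leb)\<bar> \<le> E j \<omega>"
    by (rule AE_finite_allI) (use E(2) in simp_all)
  then have AE: "AE \<omega> in sample_law D b x0 N.
      \<bar>mesh_value D b N \<omega> 0 x0 - optimal_value D 0 x0\<bar> \<le> (\<Sum>j\<in>{0..<H}. E j \<omega>)"
    using AE_space
  proof eventually_elim
    case (elim \<omega>)
    show ?case
      using elim(1) by (intro mesh_value_error[where \<omega> = \<omega>, OF N space_sampleD[OF elim(2)] _ _ x0]) auto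
  qed
  have int: "integrable (sample_law D b x0 N) (\<lambda>\<omega>. \<Sum>j\<in>{0..<H}. E j \<omega>)" using E(1) by auto
  have "(\<integral>\<^sup>+\<omega>. ennreal \<bar>mesh_value D b N \<omega> 0 x0 - optimal_value D 0 x0\<bar> \<partial>sample_law D b x0 N)
      \<le> (\<integral>\<^sup>+\<omega>. ennreal (\<Sum>j\<in>{0..<H}. E j \<omega>) \<partial>sample_law D b x0 N)"
    using AE by (intro nn_integral_mono_AE) (auto elim!: eventually_mono intro: ennreal_leI)
  \<comment> \<open>The sum is nonnegative almost surely because it dominates an absolute
    value.\<close>
  also have "\<dots> = ennreal (expectation (\<lambda>\<omega>. \<Sum>j\<in>{0..<H}. E j \<omega>))"
    using AE by (intro nn_integral_eq_integral int) (auto elim!: eventually_mono)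
  also have "expectation (\<lambda>\<omega>. \<Sum>j\<in>{0..<H}. E j \<omega>) = (\<Sum>j\<in>{0..<H}. expectation (E j))"
    using E(1) by (intro Bochner_Integration.integral_sum) auto
  also have "\<dots> \<le> (\<Sum>j\<in>{0..<H}. 24 * ((real H * G) / sqrt (real N) * R))"
    using E(3) by (intro sum_mono) auto
  also have "\<dots> = 24 * ((real H)\<^sup>2 * G / sqrt (real N)) * R"
    by (simp add: power2_eq_square)
  finally show ?thesis unfolding R_def by (simp add: ennreal_leI)
qed

text \<open>The passage to extended reals. If the entropy integral is infinite, so is the right-hand
  side; this requires the prefactor to be strictly positive, since zero times infinity is zero
  there.\<close>

lemma mesh_convergence:
  assumes N: "N \<ge> 2"
  shows "(\<integral>\<^sup>+\<omega>. ennreal \<bar>mesh_value D b N \<omega> 0 x0 - optimal_value D 0 x0\<bar> \<partial>sample_law D b x0 N)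
    \<le> ennreal (24 * ((real H)\<^sup>2 * G / sqrt (real N))) *
      ((ennreal L * dudley_integral SA + ennreal K + ennreal \<Lambda>) / ennreal \<delta> + ennreal (\<Lambda>\<^sup>2 / \<delta>\<^sup>2))"
proof (cases "dudley_integral SA")
  case (real d)
  have "ennreal ((L * d + \<Lambda>) / \<delta> + \<Lambda>\<^sup>2 / \<delta>\<^sup>2) = ennreal ((L * d + \<Lambda>) / \<delta>) + ennreal (\<Lambda>\<^sup>2 / \<delta>\<^sup>2)"
    using real(1) pos by (intro ennreal_plus) auto
  also have "ennreal ((L * d + \<Lambda>) / \<delta>) = ennreal (L * d + \<Lambda>) / ennreal \<delta>"
    using real(1) pos by (intro divide_ennreal[symmetric]) auto
  also have "ennreal (L * d + \<Lambda>) = ennreal L * dudley_integral SA + ennreal \<Lambda>"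
    using real pos by (simp add: ennreal_mult)
  also have "(ennreal L * dudley_integral SA + ennreal \<Lambda>) / ennreal \<delta> + ennreal (\<Lambda>\<^sup>2 / \<delta>\<^sup>2)
      \<le> (ennreal L * dudley_integral SA + ennreal K + ennreal \<Lambda>) / ennreal \<delta> + ennreal (\<Lambda>\<^sup>2 / \<delta>\<^sup>2)"
    by (rule add_right_mono, rule divide_right_mono_ennreal, rule add_right_mono) simp
  finally have le: "ennreal ((L * d + \<Lambda>) / \<delta> + \<Lambda>\<^sup>2 / \<delta>\<^sup>2) \<le>
      (ennreal L * dudley_integral SA + ennreal K + ennreal \<Lambda>) / ennreal \<delta> + ennreal (\<Lambda>\<^sup>2 / \<delta>\<^sup>2)" .
  have "(\<integral>\<^sup>+\<omega>. ennreal \<bar>mesh_value D b N \<omega> 0 x0 - optimal_value D 0 x0\<bar> \<partial>sample_law D b x0 N)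
      \<le> ennreal (24 * ((real H)\<^sup>2 * G / sqrt (real N)) * ((L * d + \<Lambda>) / \<delta> + \<Lambda>\<^sup>2 / \<delta>\<^sup>2))"
    using real by (intro mesh_convergence_finite[OF N]) auto
  also have "\<dots> = ennreal (24 * ((real H)\<^sup>2 * G / sqrt (real N))) * ennreal ((L * d + \<Lambda>) / \<delta> + \<Lambda>\<^sup>2 / \<delta>\<^sup>2)"
    using pos by (intro ennreal_mult') auto
  also have "\<dots> \<le> ennreal (24 * ((real H)\<^sup>2 * G / sqrt (real N))) *
      ((ennreal L * dudley_integral SA + ennreal K + ennreal \<Lambda>) / ennreal \<delta> + ennreal (\<Lambda>\<^sup>2 / \<delta>\<^sup>2))"
    using le by (rule mult_left_mono) simp
  finally show ?thesis .
next
  case top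
  have "0 < 24 * ((real H)\<^sup>2 * G / sqrt (real N))" using N pos H_pos by simp
  then show ?thesis using pos N H_pos
    by (simp add: top ennreal_mult_top ennreal_top_divide ennreal_mult_eq_top_iff)
qed

end

theorem theorem2:
  shows "\<exists>C::real. C > 0 \<and>
    (\<forall>(D::mdp) (\<delta>::real) (\<Lambda>::real) (L::real) (\<L>::point \<Rightarrow> real) (G::real)
       (x0::point) (b::nat \<Rightarrow> point).
      valid_mdp D \<longrightarrow>
      compact_space (mtopology_of (state_metric D)) \<longrightarrow>
      compact_space (mtopology_of (action_metric D)) \<longrightarrow>
      \<delta> > 0 \<longrightarrow> \<Lambda> > 0 \<longrightarrow> L > 0 \<longrightarrow>
      \<L> \<in> borel_measurable (state_leb D) \<longrightarrow>
      (\<forall>y\<in>states D. 0 \<le> \<L> y) \<longrightarrow>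
      max (\<integral>\<^sup>+y. ennreal (\<L> y) \<partial>state_leb D) (esssup (state_leb D) (\<lambda>y. ennreal (\<L> y)))
        \<le> ennreal L \<longrightarrow>
      (\<forall>h\<in>{1..horizon D}. \<forall>x\<in>states D. \<forall>a\<in>actions D. \<forall>y\<in>states D.
        \<delta> \<le> dens D h x a y \<and> dens D h x a y \<le> \<Lambda>) \<longrightarrow>
      (\<forall>h\<in>{1..horizon D}. \<forall>x1\<in>states D. \<forall>x2\<in>states D. \<forall>a1\<in>actions D. \<forall>a2\<in>actions D.
        \<forall>y\<in>states D. \<bar>dens D h x1 a1 y - dens D h x2 a2 y\<bar>
          \<le> \<L> y * (euclid_dist (state_dim D) x1 x2 + mdist (action_metric D) a1 a2)) \<longrightarrow>
      G > 0 \<longrightarrow>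
      (\<forall>h<horizon D. \<forall>s\<in>states D. \<forall>a\<in>actions D.
        max \<bar>reward D h s a\<bar> \<bar>final_reward D s\<bar> \<le> G) \<longrightarrow>
      x0 \<in> states D \<longrightarrow>
      (\<forall>h<horizon D. b h \<in> actions D) \<longrightarrow>
      regular_data D b x0 \<longrightarrow>
      (\<exists>N0. \<forall>N>N0. N \<ge> 2 \<longrightarrow>
        (\<integral>\<^sup>+\<omega>. ennreal \<bar>mesh_value D b N \<omega> 0 x0 - optimal_value D 0 x0\<bar> \<partial>sample_law D b x0 N)
        \<le> ennreal (C * ((real (horizon D))\<^sup>2 * G / sqrt (real N))) *
          ((ennreal L * dudley_integral (state_action_metric D)
             + ennreal (L * mdiam (state_metric D) * mdiam (action_metric D)) + ennreal \<Lambda>)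
             / ennreal \<delta>
           + ennreal (\<Lambda>\<^sup>2 / \<delta>\<^sup>2))))"
\<comment> \<open>The constant comes from \<open>mesh_step_error_bound\<close>; as all estimates
  hold from \<open>N = 2\<close> on, the threshold can be 0.\<close>
proof (intro exI[of _ "24::real"] conjI allI impI exI[of _ "0::nat"])
  fix D :: mdp and \<delta> \<Lambda> L G :: real and \<L> :: "point \<Rightarrow> real" and x0 :: point and b :: "nat \<Rightarrow> point"
    and N :: nat
  assume asms: "valid_mdp D" "compact_space (mtopology_of (state_metric D))"
    "compact_space (mtopology_of (action_metric D))" "\<delta> > 0" "\<Lambda> > 0" "L > 0"
    "\<L> \<in> borel_measurable (state_leb D)" "\<forall>y\<in>states D. 0 \<le> \<L> y"
    "max (\<integral>\<^sup>+y. ennreal (\<L> y) \<partial>state_leb D) (esssup (state_leb D) (\<lambda>y. ennreal (\<L> y))) \<le> ennreal L"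
    "\<forall>h\<in>{1..horizon D}. \<forall>x\<in>states D. \<forall>a\<in>actions D. \<forall>y\<in>states D.
        \<delta> \<le> dens D h x a y \<and> dens D h x a y \<le> \<Lambda>"
    "\<forall>h\<in>{1..horizon D}. \<forall>x1\<in>states D. \<forall>x2\<in>states D. \<forall>a1\<in>actions D. \<forall>a2\<in>actions D.
        \<forall>y\<in>states D. \<bar>dens D h x1 a1 y - dens D h x2 a2 y\<bar>
          \<le> \<L> y * (euclid_dist (state_dim D) x1 x2 + mdist (action_metric D) a1 a2)"
    "G > 0"
    "\<forall>h<horizon D. \<forall>s\<in>states D. \<forall>a\<in>actions D. max \<bar>reward D h s a\<bar> \<bar>final_reward D s\<bar> \<le> G"
    "x0 \<in> states D" "\<forall>h<horizon D. b h \<in> actions D" "regular_data D b x0"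
  assume N: "N \<ge> 2"
  interpret mesh_setting D \<delta> \<Lambda> L G \<L> x0 b
  proof
    show "esssup (state_leb D) (\<lambda>y. ennreal (\<L> y)) \<le> ennreal L"
      using asms(9) by (rule order_trans[OF max.cobounded2])
  qed (use asms in simp_all)
  show "(\<integral>\<^sup>+\<omega>. ennreal \<bar>mesh_value D b N \<omega> 0 x0 - optimal_value D 0 x0\<bar> \<partial>sample_law D b x0 N)
      \<le> ennreal (24 * ((real (horizon D))\<^sup>2 * G / sqrt (real N))) *
        ((ennreal L * dudley_integral (state_action_metric D)
           + ennreal (L * mdiam (state_metric D) * mdiam (action_metric D)) + ennreal \<Lambda>)
           / ennreal \<delta>
         + ennreal (\<Lambda>\<^sup>2 / \<delta>\<^sup>2))"
    by (rule mesh_convergence[OF N])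
qed simp

end
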